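(* Let $G$ be a compact Lie group and let $A$ be any closed abelian subgroup of $G$. If $G$ is acceptable, then the centralizer $Z_G(A)$ is also acceptable. If $G$ is strongly acceptable, then $Z_G(A)$ is also strongly acceptable.
   Context: Let $G$ be a Lie group and $\Gamma$ a group. Two homomorphisms $\phi_1,\phi_2:\Gamma\to G$ are element-conjugate if for every $x\in\Gamma$ the elements $\phi_1(x)$ and $\phi_2(x)$ are conjugate in $G$. They are globally conjugate if there exists $g\in G$ with $\phi_2(x)=g\phi_1(x)g^{-1}$ for all $x\in\Gamma$. $G$ is acceptable if, for every finite group $\Gamma$, any two element-conjugate homomorphisms $\Gamma\to G$ are globally conjugate. $G$ is strongly acceptable if, for every group $\Gamma$, any two element-conjugate homomorphisms $\Gamma\to G$ are globally conjugate. *)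

theory Defs
  imports "HOL-Analysis.Analysis" "HOL-Algebra.Group"
begin

section \<open>Lie groups\<close>

text \<open>\<open>C\<^sup>k\<close> maps between normed spaces; intended for open \<open>S\<close> in a finite-dimensional space, where
  continuity of all directional derivatives is continuity of the derivative.\<close>

fun Ck_on :: "nat \<Rightarrow> 'a::real_normed_vector set \<Rightarrow> ('a \<Rightarrow> 'b::real_normed_vector) \<Rightarrow> bool" where
  "Ck_on 0 S f \<longleftrightarrow> continuous_on S f"
| "Ck_on (Suc k) S f \<longleftrightarrow>
     (\<forall>x\<in>S. f differentiable (at x)) \<and> (\<forall>v. Ck_on k S (\<lambda>x. frechet_derivative f (at x) v))"

definition smooth_on :: "'a::real_normed_vector set \<Rightarrow> ('a \<Rightarrow> 'b::real_normed_vector) \<Rightarrow> bool" where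
  "smooth_on S f \<longleftrightarrow> (\<forall>k. Ck_on k S f)"

text \<open>A chart is a domain together with a coordinate map (only its values on the domain matter).\<close>

type_synonym ('a, 'e) chart = "'a set \<times> ('a \<Rightarrow> 'e)"

definition is_chart :: "'a topology \<Rightarrow> ('a, 'e::euclidean_space) chart \<Rightarrow> bool" where
  "is_chart T = (\<lambda>(U, \<phi>). openin T U \<and> open (\<phi> ` U) \<and>
     homeomorphic_map (subtopology T U) (top_of_set (\<phi> ` U)) \<phi>)"

text \<open>Atlases are not required to be maximal.\<close>

definition smooth_atlas :: "'a topology \<Rightarrow> ('a, 'e::euclidean_space) chart set \<Rightarrow> bool" where
  "smooth_atlas T \<A> \<longleftrightarrow>
     (\<forall>c\<in>\<A>. is_chart T c) \<and> (\<Union>(U, \<phi>)\<in>\<A>. U) = topspace T \<and>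
     (\<forall>(U, \<phi>)\<in>\<A>. \<forall>(V, \<psi>)\<in>\<A>. smooth_on (\<phi> ` (U \<inter> V)) (\<psi> \<circ> inv_into U \<phi>))"

definition prod_atlas ::
  "('a, 'e) chart set \<Rightarrow> ('b, 'f) chart set \<Rightarrow> ('a \<times> 'b, 'e \<times> 'f) chart set" where
  "prod_atlas \<A> \<B> = {(U \<times> V, map_prod \<phi> \<psi>) | U V \<phi> \<psi>. (U, \<phi>) \<in> \<A> \<and> (V, \<psi>) \<in> \<B>}"

definition smooth_map ::
  "'a topology \<Rightarrow> ('a, 'e::euclidean_space) chart set \<Rightarrow>
   'b topology \<Rightarrow> ('b, 'f::euclidean_space) chart set \<Rightarrow> ('a \<Rightarrow> 'b) \<Rightarrow> bool" where
  "smooth_map T \<A> T' \<B> f \<longleftrightarrow> continuous_map T T' f \<and>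
     (\<forall>(U, \<phi>)\<in>\<A>. \<forall>(V, \<psi>)\<in>\<B>. smooth_on (\<phi> ` {x \<in> U. f x \<in> V}) (\<psi> \<circ> f \<circ> inv_into U \<phi>))"

text \<open>Types of class \<open>euclidean_space\<close> have positive dimension, so the Lie groups of dimension 0,
  i.e. the (countable) discrete groups, are the second disjunct; the atlas then plays no role.\<close>

definition lie_group ::
  "('a, 'm) monoid_scheme \<Rightarrow> 'a topology \<Rightarrow> ('a, 'e::euclidean_space) chart set \<Rightarrow> bool" where
  "lie_group G T \<A> \<longleftrightarrow>
     group G \<and> topspace T = carrier G \<and> Hausdorff_space T \<and> second_countable T \<and>
     (smooth_atlas T \<A> \<and>
      smooth_map (prod_topology T T) (prod_atlas \<A> \<A>) T \<A> (\<lambda>(x, y). x \<otimes>\<^bsub>G\<^esub> y) \<and>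
      smooth_map T \<A> T \<A> (\<lambda>x. inv\<^bsub>G\<^esub> x)
      \<or> T = discrete_topology (carrier G))"

section \<open>Conjugacy of homomorphisms and acceptability\<close>

definition centralizer :: "('a, 'm) monoid_scheme \<Rightarrow> 'a set \<Rightarrow> 'a set" where
  "centralizer G A = {g \<in> carrier G. \<forall>a\<in>A. g \<otimes>\<^bsub>G\<^esub> a = a \<otimes>\<^bsub>G\<^esub> g}"

definition conjugate_in :: "('a, 'm) monoid_scheme \<Rightarrow> 'a \<Rightarrow> 'a \<Rightarrow> bool" where
  "conjugate_in G x y \<longleftrightarrow> (\<exists>g\<in>carrier G. y = g \<otimes>\<^bsub>G\<^esub> x \<otimes>\<^bsub>G\<^esub> inv\<^bsub>G\<^esub> g)"

definition element_conjugate ::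
  "('c, 'n) monoid_scheme \<Rightarrow> ('a, 'm) monoid_scheme \<Rightarrow> ('c \<Rightarrow> 'a) \<Rightarrow> ('c \<Rightarrow> 'a) \<Rightarrow> bool" where
  "element_conjugate \<Gamma> G \<phi>1 \<phi>2 \<longleftrightarrow> (\<forall>x\<in>carrier \<Gamma>. conjugate_in G (\<phi>1 x) (\<phi>2 x))"

definition globally_conjugate ::
  "('c, 'n) monoid_scheme \<Rightarrow> ('a, 'm) monoid_scheme \<Rightarrow> ('c \<Rightarrow> 'a) \<Rightarrow> ('c \<Rightarrow> 'a) \<Rightarrow> bool" where
  "globally_conjugate \<Gamma> G \<phi>1 \<phi>2 \<longleftrightarrow>
     (\<exists>g\<in>carrier G. \<forall>x\<in>carrier \<Gamma>. \<phi>2 x = g \<otimes>\<^bsub>G\<^esub> \<phi>1 x \<otimes>\<^bsub>G\<^esub> inv\<^bsub>G\<^esub> g)"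

definition element_conj_imp_global ::
  "('c, 'n) monoid_scheme \<Rightarrow> ('a, 'm) monoid_scheme \<Rightarrow> bool" where
  "element_conj_imp_global \<Gamma> G \<longleftrightarrow>
     (\<forall>\<phi>1\<in>hom \<Gamma> G. \<forall>\<phi>2\<in>hom \<Gamma> G. element_conjugate \<Gamma> G \<phi>1 \<phi>2 \<longrightarrow> globally_conjugate \<Gamma> G \<phi>1 \<phi>2)"

text \<open>A HOL formula cannot quantify over the type of \<open>\<Gamma>\<close>. It suffices to take finite groups on
  natural numbers, and arbitrary groups on the element type of \<open>G\<close>: the lemmas \<open>acceptableD\<close> and
  \<open>strongly_acceptableD\<close> below recover the property for \<open>\<Gamma>\<close> over every type.\<close>

definition acceptable :: "('a, 'm) monoid_scheme \<Rightarrow> bool" where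
  "acceptable G \<longleftrightarrow>
     (\<forall>\<Gamma> :: nat monoid. group \<Gamma> \<and> finite (carrier \<Gamma>) \<longrightarrow> element_conj_imp_global \<Gamma> G)"

definition strongly_acceptable :: "('a, 'm) monoid_scheme \<Rightarrow> bool" where
  "strongly_acceptable G \<longleftrightarrow>
     (\<forall>\<Gamma> :: 'a monoid. group \<Gamma> \<longrightarrow> element_conj_imp_global \<Gamma> G)"

lemma element_conj_imp_global_transfer:
  assumes h: "h \<in> hom \<Gamma> \<Delta>" "h ` carrier \<Gamma> = carrier \<Delta>"
    and \<phi>: "\<phi>1 \<in> hom \<Gamma> G" "\<phi>2 \<in> hom \<Gamma> G" "element_conjugate \<Gamma> G \<phi>1 \<phi>2"
    and \<psi>1: "\<And>x. x \<in> carrier \<Gamma> \<Longrightarrow> \<psi>1 (h x) = \<phi>1 x"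
    and \<psi>2: "\<And>x. x \<in> carrier \<Gamma> \<Longrightarrow> \<psi>2 (h x) = \<phi>2 x"
    and \<Gamma>: "group \<Gamma>" and \<Delta>: "element_conj_imp_global \<Delta> G"
  shows "globally_conjugate \<Gamma> G \<phi>1 \<phi>2"
proof -
  interpret group \<Gamma> by (fact \<Gamma>)
  have desc: "\<psi> \<in> hom \<Delta> G" if "\<phi> \<in> hom \<Gamma> G" "\<And>x. x \<in> carrier \<Gamma> \<Longrightarrow> \<psi> (h x) = \<phi> x" for \<phi> \<psi>
  proof (rule homI)
    show "\<psi> y \<in> carrier G" if "y \<in> carrier \<Delta>" for y
      using that h(2) \<open>\<phi> \<in> hom \<Gamma> G\<close> \<open>\<And>x. x \<in> carrier \<Gamma> \<Longrightarrow> \<psi> (h x) = \<phi> x\<close>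
      by (metis (no_types, lifting) hom_in_carrier imageE)
  next
    fix y z assume "y \<in> carrier \<Delta>" "z \<in> carrier \<Delta>"
    then obtain a b where ab: "a \<in> carrier \<Gamma>" "b \<in> carrier \<Gamma>" "y = h a" "z = h b"
      using h(2) by (metis (no_types, lifting) imageE)
    then have "y \<otimes>\<^bsub>\<Delta>\<^esub> z = h (a \<otimes>\<^bsub>\<Gamma>\<^esub> b)" by (simp add: hom_mult[OF h(1)])
    then show "\<psi> (y \<otimes>\<^bsub>\<Delta>\<^esub> z) = \<psi> y \<otimes>\<^bsub>G\<^esub> \<psi> z" using ab that by (simp add: hom_mult)
  qed
  have "element_conjugate \<Delta> G \<psi>1 \<psi>2"
    using \<phi>(3) \<psi>1 \<psi>2 unfolding element_conjugate_def h(2)[symmetric] by simp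
  then have "globally_conjugate \<Delta> G \<psi>1 \<psi>2"
    using \<Delta> desc[OF \<phi>(1) \<psi>1] desc[OF \<phi>(2) \<psi>2] unfolding element_conj_imp_global_def by blast
  then show ?thesis
    using \<psi>1 \<psi>2 unfolding globally_conjugate_def h(2)[symmetric] by simp
qed

lemma acceptableD:
  fixes \<Gamma> :: "('c, 'n) monoid_scheme"
  assumes "acceptable G" and \<Gamma>: "group \<Gamma>" and fin: "finite (carrier \<Gamma>)"
  shows "element_conj_imp_global \<Gamma> G"
  unfolding element_conj_imp_global_def
proof (intro ballI impI)
  fix \<phi>1 \<phi>2 assume \<phi>: "\<phi>1 \<in> hom \<Gamma> G" "\<phi>2 \<in> hom \<Gamma> G" "element_conjugate \<Gamma> G \<phi>1 \<phi>2"
  interpret group \<Gamma> by (fact \<Gamma>)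
  define h where "h = to_nat_on (carrier \<Gamma>)"
  define k where "k = inv_into (carrier \<Gamma>) h"
  have k: "k (h x) = x" if "x \<in> carrier \<Gamma>" for x
    unfolding k_def h_def using that fin by (intro inv_into_f_f inj_on_to_nat_on countable_finite)
  define \<Delta> :: "nat monoid" where
    "\<Delta> = \<lparr>carrier = h ` carrier \<Gamma>, mult = (\<lambda>x y. h (k x \<otimes>\<^bsub>\<Gamma>\<^esub> k y)), one = h \<one>\<^bsub>\<Gamma>\<^esub>\<rparr>"
  have "group \<Delta>"
  proof (rule groupI)
    fix x assume "x \<in> carrier \<Delta>"
    then obtain a where a: "a \<in> carrier \<Gamma>" "x = h a" by (auto simp: \<Delta>_def)
    show "\<exists>y\<in>carrier \<Delta>. y \<otimes>\<^bsub>\<Delta>\<^esub> x = \<one>\<^bsub>\<Delta>\<^esub>"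
      by (rule bexI[of _ "h (inv\<^bsub>\<Gamma>\<^esub> a)"]) (use a in \<open>auto simp: \<Delta>_def k\<close>)
  qed (auto simp: \<Delta>_def k m_assoc)
  moreover have "finite (carrier \<Delta>)" using fin by (simp add: \<Delta>_def)
  ultimately have \<Delta>: "element_conj_imp_global \<Delta> G"
    using assms(1) by (simp add: acceptable_def)
  show "globally_conjugate \<Gamma> G \<phi>1 \<phi>2"
    by (rule element_conj_imp_global_transfer[OF _ _ \<phi> _ _ \<Gamma> \<Delta>, where h = h and
          ?\<psi>1.0 = "\<phi>1 \<circ> k" and ?\<psi>2.0 = "\<phi>2 \<circ> k"])
       (auto simp: \<Delta>_def hom_def k)
qed

lemma strongly_acceptableD:
  fixes \<Gamma> :: "('c, 'n) monoid_scheme"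
  assumes "strongly_acceptable G" and G: "group G" and \<Gamma>: "group \<Gamma>"
  shows "element_conj_imp_global \<Gamma> G"
  unfolding element_conj_imp_global_def
proof (intro ballI impI)
  fix \<phi>1 \<phi>2 assume \<phi>: "\<phi>1 \<in> hom \<Gamma> G" "\<phi>2 \<in> hom \<Gamma> G" "element_conjugate \<Gamma> G \<phi>1 \<phi>2"
  interpret G: group G by (fact G)
  interpret \<Gamma>: group \<Gamma> by (fact \<Gamma>)
  interpret p1: group_hom \<Gamma> G \<phi>1 using \<phi> by unfold_locales
  interpret p2: group_hom \<Gamma> G \<phi>2 using \<phi> by unfold_locales
  define \<Delta> :: "'a monoid" where
    "\<Delta> = \<lparr>carrier = \<phi>1 ` carrier \<Gamma>, mult = mult G, one = \<one>\<^bsub>G\<^esub>\<rparr>"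
  have "group \<Delta>"
  proof (rule groupI)
    fix x assume "x \<in> carrier \<Delta>"
    then obtain a where a: "a \<in> carrier \<Gamma>" "x = \<phi>1 a" by (auto simp: \<Delta>_def)
    show "\<exists>y\<in>carrier \<Delta>. y \<otimes>\<^bsub>\<Delta>\<^esub> x = \<one>\<^bsub>\<Delta>\<^esub>"
      by (rule bexI[of _ "\<phi>1 (inv\<^bsub>\<Gamma>\<^esub> a)"])
        (use a in \<open>auto simp: \<Delta>_def simp del: p1.hom_inv simp flip: p1.hom_mult\<close>)
  next
    show "\<one>\<^bsub>\<Delta>\<^esub> \<in> carrier \<Delta>" using p1.hom_one \<Gamma>.one_closed by (force simp: \<Delta>_def)
  next
    fix x y assume "x \<in> carrier \<Delta>" "y \<in> carrier \<Delta>"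
    then show "x \<otimes>\<^bsub>\<Delta>\<^esub> y \<in> carrier \<Delta>" by (auto simp: \<Delta>_def simp flip: p1.hom_mult)
  qed (auto simp: \<Delta>_def G.m_assoc)
  then have \<Delta>: "element_conj_imp_global \<Delta> G"
    using assms(1) by (simp add: strongly_acceptable_def)
  have ker: "\<phi>2 x = \<phi>2 y" if xy: "x \<in> carrier \<Gamma>" "y \<in> carrier \<Gamma>" "\<phi>1 x = \<phi>1 y" for x y
  proof -
    let ?z = "x \<otimes>\<^bsub>\<Gamma>\<^esub> inv\<^bsub>\<Gamma>\<^esub> y"
    have z: "?z \<in> carrier \<Gamma>" "\<phi>1 ?z = \<one>\<^bsub>G\<^esub>" using xy by (auto simp: G.r_inv)
    obtain g where "g \<in> carrier G" "\<phi>2 ?z = g \<otimes>\<^bsub>G\<^esub> \<phi>1 ?z \<otimes>\<^bsub>G\<^esub> inv\<^bsub>G\<^esub> g"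
      using \<phi>(3) z(1) unfolding element_conjugate_def conjugate_in_def by blast
    then have "\<phi>2 ?z = \<one>\<^bsub>G\<^esub>" using z(2) by simp
    then have "\<phi>2 x \<otimes>\<^bsub>G\<^esub> inv\<^bsub>G\<^esub> \<phi>2 y = \<one>\<^bsub>G\<^esub>" using xy by simp
    then show ?thesis using xy G.inv_equality[of "\<phi>2 x" "inv\<^bsub>G\<^esub> \<phi>2 y"] by simp
  qed
  have \<psi>2: "(\<phi>2 \<circ> inv_into (carrier \<Gamma>) \<phi>1) (\<phi>1 x) = \<phi>2 x" if "x \<in> carrier \<Gamma>" for x
    unfolding comp_apply by (rule ker) (use that in \<open>auto intro: f_inv_into_f inv_into_into\<close>)
  show "globally_conjugate \<Gamma> G \<phi>1 \<phi>2"
    by (rule element_conj_imp_global_transfer[OF _ _ \<phi> _ _ \<Gamma> \<Delta>, where h = \<phi>1 and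
          ?\<psi>1.0 = "\<lambda>y. y" and ?\<psi>2.0 = "\<phi>2 \<circ> inv_into (carrier \<Gamma>) \<phi>1"])
       (use \<psi>2 in \<open>auto simp: \<Delta>_def hom_def\<close>)
qed

end

theory Submission
  imports Defs "HOL-Algebra.Multiplicative_Group"
begin

text \<open>If a subgroup \<open>H\<close> is central in \<open>Z = centralizer G A\<close>, then homomorphisms \<open>\<phi>1\<close>, \<open>\<phi>2\<close> from
  \<open>\<Gamma>\<close> to \<open>Z\<close> that are element-conjugate in \<open>Z\<close> extend to element-conjugate homomorphisms
  \<open>(x, h) \<mapsto> \<phi>i x \<cdot> h\<close> from \<open>\<Gamma> \<times> H\<close> to \<open>G\<close>, and a global conjugator of the extensions centralizes \<open>H\<close>.
  With \<open>H = A\<close> this settles strong acceptability.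

  For finite \<open>\<Gamma>\<close> only finite \<open>H\<close> are allowed. Let \<open>B\<close> be the double centralizer of \<open>A\<close>, which contains
  \<open>A\<close> and is central in \<open>Z\<close>. Every finite set of torsion elements of \<open>B\<close> lies in a finite subgroup
  \<open>H\<close> of \<open>B\<close>, so by compactness some conjugator commutes with all torsion elements of \<open>B\<close>. These are
  dense in \<open>B\<close>, so it centralizes \<open>A\<close>.

  Density: for \<open>a\<close> in \<open>B\<close> some power \<open>a^n\<close>, \<open>n > 0\<close>, is close to \<open>1\<close> by compactness and has a unique
  small \<open>n\<close>-th root \<open>b\<close>. By uniqueness \<open>b\<close> commutes with everything that commutes with \<open>a\<close>, so
  \<open>b\<close> lies in \<open>B\<close>, and \<open>a b\<^sup>-\<^sup>1\<close> is a torsion element near \<open>a\<close>. Working in the double centralizer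
  instead of \<open>A\<close> avoids the closed subgroup theorem.\<close>

section \<open>Centralizers and conjugators\<close>

lemma (in group) centralizer_subgroup:
  assumes "A \<subseteq> carrier G"
  shows "subgroup (centralizer G A) G"
proof (rule subgroupI)
  have "\<one> \<in> centralizer G A" using assms by (auto simp: centralizer_def)
  then show "centralizer G A \<noteq> {}" by blast
next
  fix g assume g: "g \<in> centralizer G A"
  then have gG: "g \<in> carrier G" by (simp add: centralizer_def)
  have "inv g \<otimes> a = a \<otimes> inv g" if "a \<in> A" for a
  proof -
    have a: "a \<in> carrier G" "g \<otimes> a = a \<otimes> g" using that g assms by (auto simp: centralizer_def)
    have "a \<otimes> inv g = inv g \<otimes> (g \<otimes> a) \<otimes> inv g" using a(1) gG by (simp add: m_assoc[symmetric])
    also have "\<dots> = inv g \<otimes> a" using a gG by (simp add: m_assoc)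
    finally show ?thesis ..
  qed
  then show "inv g \<in> centralizer G A" using gG by (simp add: centralizer_def)
next
  fix g h assume gh: "g \<in> centralizer G A" "h \<in> centralizer G A"
  have "g \<otimes> h \<otimes> a = a \<otimes> (g \<otimes> h)" if "a \<in> A" for a
  proof -
    have mem: "g \<in> carrier G" "h \<in> carrier G" "a \<in> carrier G"
      and comm: "g \<otimes> a = a \<otimes> g" "h \<otimes> a = a \<otimes> h"
      using that gh assms by (auto simp: centralizer_def)
    have "g \<otimes> h \<otimes> a = g \<otimes> a \<otimes> h" using mem comm(2) by (simp add: m_assoc)
    then show ?thesis using mem comm(1) by (simp add: m_assoc)
  qed
  then show "g \<otimes> h \<in> centralizer G A" using gh by (simp add: centralizer_def)
qed (auto simp: centralizer_def)

lemma centralizer_antimono: "A \<subseteq> B \<Longrightarrow> centralizer G B \<subseteq> centralizer G A"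
  by (auto simp: centralizer_def)

lemma subset_double_centralizer: "A \<subseteq> carrier G \<Longrightarrow> A \<subseteq> centralizer G (centralizer G A)"
  by (auto simp: centralizer_def)

lemma (in group) comm_group_restrictI:
  assumes "subgroup H G" "\<And>x y. x \<in> H \<Longrightarrow> y \<in> H \<Longrightarrow> x \<otimes> y = y \<otimes> x"
  shows "comm_group (G\<lparr>carrier := H\<rparr>)"
  by (rule group.group_comm_groupI[OF subgroup_imp_group[OF assms(1)]]) (use assms(2) in simp)

lemma (in group) conj_pow:
  assumes "h \<in> carrier G" "b \<in> carrier G"
  shows "(h \<otimes> b \<otimes> inv h) [^] (k::nat) = h \<otimes> b [^] k \<otimes> inv h"
proof (induction k)
  case (Suc k)
  have "inv h \<otimes> (h \<otimes> y) = y" if "y \<in> carrier G" for y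
    using that assms by (simp add: m_assoc[symmetric])
  then show ?case using Suc assms by (simp add: m_assoc)
qed (use assms in \<open>simp add: r_inv\<close>)

text \<open>Induction on \<open>F\<close>: a torsion element generates a finite cyclic subgroup, and
  in a commutative group the product of two finite subgroups is a finite subgroup containing
  both.\<close>

lemma (in comm_group) finite_torsion_subset:
  assumes "finite F" "F \<subseteq> carrier G" "\<And>t. t \<in> F \<Longrightarrow> \<exists>n::nat. n > 0 \<and> t [^] n = \<one>"
  shows "\<exists>H. subgroup H G \<and> finite H \<and> F \<subseteq> H"
  using assms
proof (induction F rule: finite_induct)
  case empty
  show ?case using triv_subgroup by blast
next
  case (insert t F)
  then obtain H where H: "subgroup H G" "finite H" "F \<subseteq> H" by auto
  define K where "K = carrier (subgroup_generated G {t})"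
  have t: "t \<in> carrier G" using insert by simp
  have K: "subgroup K G" "t \<in> K" "finite K"
  proof -
    show "subgroup K G" unfolding K_def by (rule subgroup_subgroup_generated)
    show "t \<in> K" using t by (simp add: K_def carrier_subgroup_generated generate.incl)
    obtain n :: nat where "n > 0" "t [^] n = \<one>" using insert.prems(2)[of t] by auto
    then show "finite K" unfolding K_def finite_cyclic_subgroup[OF t] by auto
  qed
  have "finite (H <#> K)" using H K by (simp add: set_mult_def)
  moreover have "subgroup (H <#> K) G" by (rule mult_subgroups[OF H(1) K(1)])
  moreover have "H \<subseteq> H <#> K" "K \<subseteq> H <#> K"
  proof -
    have one: "\<one> \<in> H" "\<one> \<in> K" using H K by (auto intro: subgroup.one_closed)
    have "H \<subseteq> carrier G" "K \<subseteq> carrier G" using H K by (auto dest: subgroup.subset)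
    then show "H \<subseteq> H <#> K" "K \<subseteq> H <#> K"
      using one unfolding set_mult_def by (force intro: r_one[symmetric] l_one[symmetric])+
  qed
  ultimately show ?case using H K by blast
qed

section \<open>Extending homomorphisms by a central factor\<close>

text \<open>An element \<open>z\<close> of \<open>Z\<close> that conjugates \<open>\<phi>1 x\<close>
  to \<open>\<phi>2 x\<close> commutes with \<open>h\<close>, hence also conjugates the extensions
  at \<open>(x, h)\<close>. A global conjugator \<open>g\<close> of the extensions is then read off
  twice: at \<open>(\<one>, h)\<close> both take the value \<open>h\<close>, so \<open>g\<close>
  commutes with \<open>h\<close>; at \<open>(x, \<one>)\<close> they are \<open>\<phi>1 x\<close>
  and \<open>\<phi>2 x\<close>.\<close>

lemma (in group) conjugator_centralizing:
  assumes Z: "subgroup Z G" and H: "subgroup H G" "H \<subseteq> Z" "H \<subseteq> centralizer G Z"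
    and \<phi>: "\<phi>1 \<in> hom \<Gamma> (G\<lparr>carrier := Z\<rparr>)" "\<phi>2 \<in> hom \<Gamma> (G\<lparr>carrier := Z\<rparr>)"
      "element_conjugate \<Gamma> (G\<lparr>carrier := Z\<rparr>) \<phi>1 \<phi>2"
    and \<Gamma>: "group \<Gamma>"
    and acc: "element_conj_imp_global (\<Gamma> \<times>\<times> G\<lparr>carrier := H\<rparr>) G"
  shows "\<exists>g\<in>centralizer G H. \<forall>x\<in>carrier \<Gamma>. \<phi>2 x = g \<otimes> \<phi>1 x \<otimes> inv g"
proof -
  interpret \<Gamma>: group \<Gamma> by (fact \<Gamma>)
  interpret Z: group "G\<lparr>carrier := Z\<rparr>" by (rule subgroup_imp_group[OF Z])
  have ZG: "Z \<subseteq> carrier G" and HG: "H \<subseteq> carrier G" using Z H by (auto dest: subgroup.subset)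
  have comm: "z \<otimes> h = h \<otimes> z" if "z \<in> Z" "h \<in> H" for z h
    using that H(3) by (auto simp: centralizer_def)
  define ext where "ext = (\<lambda>\<phi> (x::'c, h). \<phi> x \<otimes> h)"
  have val: "\<phi> x \<in> Z" if "\<phi> \<in> hom \<Gamma> (G\<lparr>carrier := Z\<rparr>)" "x \<in> carrier \<Gamma>" for \<phi> x
    using hom_in_carrier[OF that] by simp
  have hom: "ext \<phi> \<in> hom (\<Gamma> \<times>\<times> G\<lparr>carrier := H\<rparr>) G" if \<phi>: "\<phi> \<in> hom \<Gamma> (G\<lparr>carrier := Z\<rparr>)" for \<phi>
  proof (rule homI)
    fix p assume "p \<in> carrier (\<Gamma> \<times>\<times> G\<lparr>carrier := H\<rparr>)"
    then show "ext \<phi> p \<in> carrier G" using val[OF \<phi>] ZG HG by (auto simp: ext_def)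
  next
    fix p q assume "p \<in> carrier (\<Gamma> \<times>\<times> G\<lparr>carrier := H\<rparr>)" "q \<in> carrier (\<Gamma> \<times>\<times> G\<lparr>carrier := H\<rparr>)"
    then obtain x h y k where p: "p = (x, h)" "x \<in> carrier \<Gamma>" "h \<in> H"
      and q: "q = (y, k)" "y \<in> carrier \<Gamma>" "k \<in> H" by (cases p; cases q) auto
    have mem: "\<phi> x \<in> carrier G" "\<phi> y \<in> carrier G" "h \<in> carrier G" "k \<in> carrier G"
      using val[OF \<phi>] p q ZG HG by auto
    have "\<phi> x \<otimes> \<phi> y \<otimes> (h \<otimes> k) = \<phi> x \<otimes> (\<phi> y \<otimes> h) \<otimes> k" using mem by (simp add: m_assoc)
    also have "\<phi> y \<otimes> h = h \<otimes> \<phi> y" using comm val[OF \<phi>] p q by auto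
    finally have "\<phi> x \<otimes> \<phi> y \<otimes> (h \<otimes> k) = \<phi> x \<otimes> h \<otimes> (\<phi> y \<otimes> k)" using mem by (simp add: m_assoc)
    then show "ext \<phi> (p \<otimes>\<^bsub>\<Gamma> \<times>\<times> G\<lparr>carrier := H\<rparr>\<^esub> q) = ext \<phi> p \<otimes> ext \<phi> q"
      using p q hom_mult[OF \<phi>] by (simp add: ext_def)
  qed
  have conj_ext: "ext \<phi>2 (x, h) = z \<otimes> ext \<phi>1 (x, h) \<otimes> inv z"
    if "x \<in> carrier \<Gamma>" "h \<in> H" "z \<in> Z" "\<phi>2 x = z \<otimes> \<phi>1 x \<otimes> inv z" for x h z
  proof -
    have mem: "\<phi>1 x \<in> carrier G" "h \<in> carrier G" "z \<in> carrier G"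
      using val[OF \<phi>(1)] that ZG HG by auto
    have "inv z \<otimes> h = h \<otimes> inv z" using comm that subgroup.m_inv_closed[OF Z] by auto
    then show ?thesis using mem that(4) by (simp add: ext_def m_assoc)
  qed
  have "element_conjugate (\<Gamma> \<times>\<times> G\<lparr>carrier := H\<rparr>) G (ext \<phi>1) (ext \<phi>2)"
    unfolding element_conjugate_def
  proof
    fix p assume "p \<in> carrier (\<Gamma> \<times>\<times> G\<lparr>carrier := H\<rparr>)"
    then obtain x h where p: "p = (x, h)" "x \<in> carrier \<Gamma>" "h \<in> H" by (cases p) auto
    obtain z where "z \<in> Z" "\<phi>2 x = z \<otimes> \<phi>1 x \<otimes> inv z"
      using \<phi>(3) p(2) by (auto simp: element_conjugate_def conjugate_in_def m_inv_consistent[OF Z])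
    then show "conjugate_in G (ext \<phi>1 p) (ext \<phi>2 p)"
      using conj_ext p ZG unfolding conjugate_in_def by blast
  qed
  then have "globally_conjugate (\<Gamma> \<times>\<times> G\<lparr>carrier := H\<rparr>) G (ext \<phi>1) (ext \<phi>2)"
    using acc hom[OF \<phi>(1)] hom[OF \<phi>(2)] unfolding element_conj_imp_global_def by blast
  then obtain g where g: "g \<in> carrier G"
    and conj: "\<And>x h. x \<in> carrier \<Gamma> \<Longrightarrow> h \<in> H \<Longrightarrow> ext \<phi>2 (x, h) = g \<otimes> ext \<phi>1 (x, h) \<otimes> inv g"
    unfolding globally_conjugate_def by auto
  have one: "\<phi> \<one>\<^bsub>\<Gamma>\<^esub> = \<one>" if "\<phi> \<in> hom \<Gamma> (G\<lparr>carrier := Z\<rparr>)" for \<phi>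
    using hom_one[OF that \<Gamma> Z.is_group] by simp
  have "g \<otimes> h = h \<otimes> g" if "h \<in> H" for h
  proof -
    have h: "h \<in> carrier G" using that HG by auto
    have "h = g \<otimes> h \<otimes> inv g"
      using conj[OF \<Gamma>.one_closed that] one[OF \<phi>(1)] one[OF \<phi>(2)] h by (simp add: ext_def)
    then show ?thesis using g h by (metis inv_solve_right m_closed)
  qed
  then have "g \<in> centralizer G H" using g by (simp add: centralizer_def)
  moreover have "\<phi>2 x = g \<otimes> \<phi>1 x \<otimes> inv g" if "x \<in> carrier \<Gamma>" for x
  proof -
    have "\<phi>1 x \<in> carrier G" "\<phi>2 x \<in> carrier G"
      using val[OF \<phi>(1) that] val[OF \<phi>(2) that] ZG by auto
    then show ?thesis using conj[OF that subgroup.one_closed[OF H(1)]] by (simp add: ext_def)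
  qed
  ultimately show ?thesis by blast
qed

lemma (in group) globally_conjugate_restrict:
  assumes "subgroup Z G" "g \<in> Z" "\<forall>x\<in>carrier \<Gamma>. \<phi>2 x = g \<otimes> \<phi>1 x \<otimes> inv g"
  shows "globally_conjugate \<Gamma> (G\<lparr>carrier := Z\<rparr>) \<phi>1 \<phi>2"
  using assms by (auto simp: globally_conjugate_def m_inv_consistent intro!: bexI[of _ g])

lemma (in group) strongly_acceptable_centralizer:
  assumes acc: "strongly_acceptable G" and A: "subgroup A G" "comm_group (G\<lparr>carrier := A\<rparr>)"
  shows "strongly_acceptable (G\<lparr>carrier := centralizer G A\<rparr>)"
  unfolding strongly_acceptable_def element_conj_imp_global_def
proof (intro allI impI ballI)
  let ?Z = "centralizer G A"
  fix \<Gamma> :: "'a monoid" and \<phi>1 \<phi>2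
  assume \<Gamma>: "group \<Gamma>" and \<phi>: "\<phi>1 \<in> hom \<Gamma> (G\<lparr>carrier := ?Z\<rparr>)" "\<phi>2 \<in> hom \<Gamma> (G\<lparr>carrier := ?Z\<rparr>)"
      "element_conjugate \<Gamma> (G\<lparr>carrier := ?Z\<rparr>) \<phi>1 \<phi>2"
  have AG: "A \<subseteq> carrier G" using A(1) by (rule subgroup.subset)
  have Z: "subgroup ?Z G" using AG by (rule centralizer_subgroup)
  have AZ: "A \<subseteq> ?Z"
    using AG comm_monoid.m_comm[OF comm_group.axioms(1)[OF A(2)]] by (auto simp: centralizer_def)
  \<comment> \<open>The elements of the product are pairs, so the property is needed for a group
    over another type than \<open>'a\<close>.\<close>
  have "element_conj_imp_global (\<Gamma> \<times>\<times> G\<lparr>carrier := A\<rparr>) G"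
    by (intro strongly_acceptableD[OF acc] DirProd_group \<Gamma> is_group subgroup_imp_group A)
  from conjugator_centralizing[OF Z A(1) AZ subset_double_centralizer[OF AG] \<phi> \<Gamma> this]
  obtain g where "g \<in> ?Z" "\<forall>x\<in>carrier \<Gamma>. \<phi>2 x = g \<otimes> \<phi>1 x \<otimes> inv g" by blast
  then show "globally_conjugate \<Gamma> (G\<lparr>carrier := ?Z\<rparr>) \<phi>1 \<phi>2"
    by (rule globally_conjugate_restrict[OF Z])
qed

section \<open>Compact groups with small roots\<close>

locale top_group = group G for G (structure) +
  fixes T :: "'a topology"
  assumes topspace_eq: "topspace T = carrier G"
    and Hausdorff: "Hausdorff_space T"
    and mult_cont: "continuous_map (prod_topology T T) T (\<lambda>(x, y). x \<otimes> y)"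
    and inv_cont: "continuous_map T T (\<lambda>x. inv x)"
begin

lemma continuous_map_mult:
  assumes "continuous_map X T f" "continuous_map X T g"
  shows "continuous_map X T (\<lambda>x. f x \<otimes> g x)"
  using continuous_map_compose[OF continuous_map_pairedI[OF assms] mult_cont] by (simp add: comp_def)

lemma continuous_map_inv: "continuous_map X T f \<Longrightarrow> continuous_map X T (\<lambda>x. inv f x)"
  using continuous_map_compose[OF _ inv_cont] by (simp add: comp_def)

lemma closedin_eqn:
  assumes "continuous_map T T f" "continuous_map T T g"
  shows "closedin T {x \<in> carrier G. f x = g x}"
  using closedin_continuous_maps_eq[OF Hausdorff assms] by (simp add: topspace_eq)

section \<open>Consequences of compactness\<close>

text \<open>Pigeonhole: finitely many open sets \<open>N\<close> with
  \<open>x \<otimes> inv y \<in> V\<close> for all \<open>x\<close>, \<open>y\<close> in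
  \<open>N\<close> cover the group, so two powers \<open>a [^] i\<close> and \<open>a [^] j\<close>
  with \<open>i < j\<close> lie in the same one, and their quotient is
  \<open>a [^] (j - i)\<close>.\<close>

lemma power_recurrent:
  assumes comp: "compact_space T" and a: "a \<in> carrier G" and V: "openin T V" "\<one> \<in> V"
  shows "\<exists>n::nat. n > 0 \<and> a [^] n \<in> V"
proof -
  define D where "D = {p \<in> topspace (prod_topology T T). fst p \<otimes> inv snd p \<in> V}"
  have D: "openin (prod_topology T T) D"
    unfolding D_def
    by (rule openin_continuous_map_preimage[OF continuous_map_mult[OF continuous_map_fst continuous_map_inv[OF continuous_map_snd]] V(1)])
  define \<U> where "\<U> = {N. openin T N \<and> N \<times> N \<subseteq> D}"
  have "\<Union>\<U> = topspace T"
  proof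
    show "\<Union>\<U> \<subseteq> topspace T" by (auto simp: \<U>_def dest: openin_subset)
    show "topspace T \<subseteq> \<Union>\<U>"
    proof
      fix x assume x: "x \<in> topspace T"
      then have "(x, x) \<in> D" using V(2) by (simp add: D_def topspace_eq r_inv)
      then obtain N1 N2 where "openin T N1" "openin T N2" "x \<in> N1" "x \<in> N2" "N1 \<times> N2 \<subseteq> D"
        using D unfolding openin_prod_topology_alt by metis
      then have "N1 \<inter> N2 \<in> \<U>" "x \<in> N1 \<inter> N2" by (auto simp: \<U>_def)
      then show "x \<in> \<Union>\<U>" by blast
    qed
  qed
  then obtain \<F> where \<F>: "finite \<F>" "\<F> \<subseteq> \<U>" "\<Union>\<F> = topspace T"
    using comp unfolding compact_space by (metis (no_types, lifting) \<U>_def mem_Collect_eq)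
  have "\<forall>n. \<exists>N\<in>\<F>. a [^] (n::nat) \<in> N" using \<F>(3) a by (metis UnionE nat_pow_closed topspace_eq)
  then obtain c where c: "\<And>n. c n \<in> \<F>" "\<And>n. a [^] (n::nat) \<in> c n" by metis
  have "\<not> inj c" using \<F>(1) c(1) by (metis finite_imageD finite_subset image_subsetI infinite_UNIV_nat)
  then obtain i j where ij: "i < j" "c i = c j" by (metis injI nat_neq_iff)
  have "(a [^] j, a [^] i) \<in> D"
    using c[of i] c[of j] ij \<F>(2) by (auto simp: \<U>_def)
  then have "a [^] j \<otimes> inv (a [^] i) \<in> V" by (simp add: D_def)
  also have "a [^] j = a [^] (j - i) \<otimes> a [^] i" using a ij by (simp add: nat_pow_mult)
  also have "\<dots> \<otimes> inv (a [^] i) = a [^] (j - i)" using a by (simp add: m_assoc r_inv)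
  finally show ?thesis using ij by (intro exI[of _ "j - i"]) simp
qed

text \<open>The map \<open>(h, x) \<mapsto> h \<otimes> x \<otimes> inv h\<close> sends all of
  \<open>carrier G \<times> {\<one>}\<close> to \<open>\<one>\<close>, so the tube lemma for the
  compact first factor applies.\<close>

lemma conjugation_neighbourhood:
  assumes comp: "compact_space T" and U: "openin T U" "\<one> \<in> U"
  shows "\<exists>W. openin T W \<and> \<one> \<in> W \<and> (\<forall>h\<in>carrier G. \<forall>x\<in>W. h \<otimes> x \<otimes> inv h \<in> U)"
proof -
  define D where "D = {p \<in> topspace (prod_topology T T). fst p \<otimes> snd p \<otimes> inv fst p \<in> U}"
  have D: "openin (prod_topology T T) D"
    unfolding D_def
    by (rule openin_continuous_map_preimage[OF continuous_map_mult[OF continuous_map_mult[OF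
              continuous_map_fst continuous_map_snd] continuous_map_inv[OF continuous_map_fst]] U(1)])
  have "topspace T \<times> {\<one>} \<subseteq> D" using U(2) by (auto simp: D_def topspace_eq r_inv)
  then obtain V W where "topspace T \<subseteq> V" "openin T W" "\<one> \<in> W" "V \<times> W \<subseteq> D"
    using tube_lemma_left[OF D] comp topspace_eq unfolding compact_space_def by (metis one_closed)
  then have "h \<otimes> x \<otimes> inv h \<in> U" if "h \<in> carrier G" "x \<in> W" for h x
    using that by (force simp: D_def topspace_eq)
  then show ?thesis using \<open>openin T W\<close> \<open>\<one> \<in> W\<close> by blast
qed

text \<open>A substitute for the exponential map: elements near \<open>\<one>\<close> have \<open>n\<close>-th roots whose powers stay
  near \<open>\<one>\<close>, uniformly in \<open>n\<close>, and such roots are unique.\<close>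

definition unique_roots :: "'a set \<Rightarrow> bool" where
  "unique_roots U \<longleftrightarrow>
     (\<forall>b\<in>carrier G. \<forall>c\<in>carrier G. \<forall>n>0. (\<forall>k\<le>n. b [^] (k::nat) \<in> U) \<longrightarrow>
        (\<forall>k\<le>n. c [^] k \<in> U) \<longrightarrow> b [^] n = c [^] n \<longrightarrow> b = c)"

definition has_roots :: "'a set \<Rightarrow> 'a set \<Rightarrow> bool" where
  "has_roots V W \<longleftrightarrow>
     (\<forall>v\<in>V. \<forall>n>0. \<exists>b\<in>carrier G. b [^] (n::nat) = v \<and> (\<forall>k\<le>n. b [^] k \<in> W))"

text \<open>Uniqueness holds in one fixed \<open>U\<close>, existence in arbitrarily small
  \<open>W\<close>, so that \<open>W\<close> can be adapted to \<open>U\<close> later. The condition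
  on all powers up to \<open>n\<close> matters: an element of order \<open>n\<close> near
  \<open>\<one>\<close> has the same \<open>n\<close>-th power as \<open>\<one>\<close>, but in
  general its intermediate powers leave \<open>U\<close>.\<close>

definition small_roots :: bool where
  "small_roots \<longleftrightarrow>
     (\<exists>U. openin T U \<and> \<one> \<in> U \<and> unique_roots U) \<and>
     (\<forall>W. openin T W \<longrightarrow> \<one> \<in> W \<longrightarrow> (\<exists>V. openin T V \<and> \<one> \<in> V \<and> has_roots V W))"

section \<open>Torsion in centralizers and the acceptable case\<close>

lemma torsion_dense_centralizer:
  assumes comp: "compact_space T" and roots: small_roots
    and Z: "Z \<subseteq> carrier G" and a: "a \<in> centralizer G Z" and N: "openin T N" "a \<in> N"
  shows "\<exists>t\<in>centralizer G Z \<inter> N. \<exists>n::nat. n > 0 \<and> t [^] n = \<one>"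
proof -
  have C: "subgroup (centralizer G Z) G" by (rule centralizer_subgroup[OF Z])
  have aG: "a \<in> carrier G" using a by (simp add: centralizer_def)
  obtain U where U: "openin T U" "\<one> \<in> U" "unique_roots U"
    using roots unfolding small_roots_def by blast
  obtain W1 where W1: "openin T W1" "\<one> \<in> W1" "\<And>h x. h \<in> carrier G \<Longrightarrow> x \<in> W1 \<Longrightarrow> h \<otimes> x \<otimes> inv h \<in> U"
    using conjugation_neighbourhood[OF comp U(1,2)] by blast
  \<comment> \<open>The root \<open>b = b [^] 1\<close> will lie in \<open>W2\<close>, which puts
    the torsion element \<open>a \<otimes> inv b\<close> into \<open>N\<close>.\<close>
  define W2 where "W2 = {x \<in> topspace T. a \<otimes> inv x \<in> N}"
  have W2: "openin T W2" "\<one> \<in> W2"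
  proof -
    show "openin T W2" unfolding W2_def
      by (rule openin_continuous_map_preimage[OF continuous_map_mult[OF _ inv_cont] N(1)])
        (simp add: topspace_eq aG)
    show "\<one> \<in> W2" using N(2) aG by (simp add: W2_def topspace_eq)
  qed
  have W: "openin T (W1 \<inter> W2)" "\<one> \<in> W1 \<inter> W2" using W1 W2 by auto
  obtain V where V: "openin T V" "\<one> \<in> V" "has_roots V (W1 \<inter> W2)"
    using roots W unfolding small_roots_def by blast
  obtain n :: nat where n: "n > 0" "a [^] n \<in> V" using power_recurrent[OF comp aG V(1,2)] by blast
  then obtain b where b: "b \<in> carrier G" "b [^] n = a [^] n" "\<And>k. k \<le> n \<Longrightarrow> b [^] k \<in> W1 \<inter> W2"
    using V(3) unfolding has_roots_def by blast
  \<comment> \<open>Both \<open>b\<close> and \<open>h \<otimes> b \<otimes> inv h\<close> are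
    \<open>n\<close>-th roots of \<open>a [^] n\<close>. The choice of \<open>W1\<close> keeps the
    powers of the conjugate in \<open>U\<close>, and, taken at \<open>\<one>\<close> instead of
    \<open>h\<close>, those of \<open>b\<close>; so the two roots agree.\<close>
  have commutes: "b \<otimes> h = h \<otimes> b" if h: "h \<in> carrier G" "a \<otimes> h = h \<otimes> a" for h
  proof -
    have "h \<otimes> a \<otimes> inv h = a" using h aG by (metis inv_solve_right m_closed)
    then have "h \<otimes> a [^] n \<otimes> inv h = a [^] n" using conj_pow[OF h(1) aG] by metis
    then have "(h \<otimes> b \<otimes> inv h) [^] n = b [^] n" using conj_pow[OF h(1) b(1)] b(2) by simp
    moreover have "\<forall>k\<le>n. (h \<otimes> b \<otimes> inv h) [^] k \<in> U"
      using conj_pow[OF h(1) b(1)] W1(3)[OF h(1)] b(3) by simp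
    moreover have "\<forall>k\<le>n. b [^] k \<in> U"
    proof (intro allI impI)
      fix k assume "k \<le> n"
      then show "b [^] k \<in> U" using W1(3)[OF one_closed, of "b [^] k"] b(1,3) by simp
    qed
    ultimately have "h \<otimes> b \<otimes> inv h = b" using U(3) h b(1) n(1) unfolding unique_roots_def by simp
    then show ?thesis using h b(1) by (metis inv_solve_right m_closed)
  qed
  have "b \<in> centralizer G Z"
    using a b(1) commutes Z by (auto simp: centralizer_def)
  then have "a \<otimes> inv b \<in> centralizer G Z"
    using a C by (simp add: subgroup.m_closed subgroup.m_inv_closed)
  moreover have "a \<otimes> inv b \<in> N"
    using b(3)[of 1] n(1) b(1) by (simp add: W2_def)
  moreover have "(a \<otimes> inv b) [^] n = \<one>"
  proof -
    have "b \<otimes> a = a \<otimes> b" by (rule commutes[OF aG refl])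
    then have "inv b \<otimes> a = a \<otimes> inv b" using aG b(1) by (metis inv_closed inv_solve_left' inv_solve_right' m_assoc m_closed)
    then have "(a \<otimes> inv b) [^] n = a [^] n \<otimes> (inv b) [^] n"
      using aG b(1) by (intro pow_mult_distrib) auto
    also have "\<dots> = \<one>" using aG b(1,2) by (simp add: nat_pow_inv r_inv)
    finally show ?thesis .
  qed
  ultimately show ?thesis using n(1) by blast
qed

lemma acceptable_centralizer:
  assumes comp: "compact_space T" and roots: small_roots and acc: "acceptable G"
    and A: "subgroup A G" "comm_group (G\<lparr>carrier := A\<rparr>)"
  shows "acceptable (G\<lparr>carrier := centralizer G A\<rparr>)"
  unfolding acceptable_def element_conj_imp_global_def
proof (intro allI impI ballI, elim conjE)
  let ?Z = "centralizer G A" and ?B = "centralizer G (centralizer G A)"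
  fix \<Gamma> :: "nat monoid" and \<phi>1 \<phi>2
  assume \<Gamma>: "group \<Gamma>" "finite (carrier \<Gamma>)"
    and \<phi>: "\<phi>1 \<in> hom \<Gamma> (G\<lparr>carrier := ?Z\<rparr>)" "\<phi>2 \<in> hom \<Gamma> (G\<lparr>carrier := ?Z\<rparr>)"
      "element_conjugate \<Gamma> (G\<lparr>carrier := ?Z\<rparr>) \<phi>1 \<phi>2"
  have AG: "A \<subseteq> carrier G" using A(1) by (rule subgroup.subset)
  have Z: "subgroup ?Z G" using AG by (rule centralizer_subgroup)
  then have ZG: "?Z \<subseteq> carrier G" by (rule subgroup.subset)
  have B: "subgroup ?B G" using ZG by (rule centralizer_subgroup)
  have AB: "A \<subseteq> ?B" using AG by (rule subset_double_centralizer)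
  have AZ: "A \<subseteq> ?Z"
    using AG comm_monoid.m_comm[OF comm_group.axioms(1)[OF A(2)]] by (auto simp: centralizer_def)
  \<comment> \<open>As \<open>A\<close> is commutative, \<open>A \<subseteq> ?Z\<close>, and taking
    centralizers reverses this. Elements of \<open>?B\<close> thus lie in \<open>?Z\<close>, which
    \<open>?B\<close> centralizes, so \<open>?B\<close> is commutative.\<close>
  have BZ: "?B \<subseteq> ?Z" using AZ by (rule centralizer_antimono)
  interpret B: comm_group "G\<lparr>carrier := ?B\<rparr>"
    by (rule comm_group_restrictI[OF B]) (use BZ in \<open>auto simp: centralizer_def\<close>)
  have pow_B: "x [^]\<^bsub>G\<lparr>carrier := ?B\<rparr>\<^esub> (n::nat) = x [^] n" for x n
    by (simp add: nat_pow_def)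
  define Tor where "Tor = {t \<in> ?B. \<exists>n::nat. n > 0 \<and> t [^] n = \<one>}"
  \<comment> \<open>\<open>K\<close> is the set of elements of \<open>G\<close> that conjugate
    \<open>\<phi>1\<close> to \<open>\<phi>2\<close>. Written as equations it is an intersection of
    equalizers of continuous maps, hence closed.\<close>
  define K where "K = (\<Inter>x\<in>carrier \<Gamma>. {g \<in> carrier G. \<phi>2 x \<otimes> g = g \<otimes> \<phi>1 x})"
  define C where "C = (\<lambda>t. K \<inter> {g \<in> carrier G. g \<otimes> t = t \<otimes> g})"
  have val: "\<phi> x \<in> carrier G" if "\<phi> \<in> hom \<Gamma> (G\<lparr>carrier := ?Z\<rparr>)" "x \<in> carrier \<Gamma>" for \<phi> x
    using hom_in_carrier[OF that] ZG by auto
  have const: "continuous_map T T (\<lambda>_. x)" if "x \<in> carrier G" for x using that by (simp add: topspace_eq)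
  have one_\<Gamma>: "carrier \<Gamma> \<noteq> {}" using \<Gamma>(1) group.is_monoid monoid.one_closed by blast
  have "closedin T K" unfolding K_def
    using one_\<Gamma> val \<phi> const by (intro closedin_INT closedin_eqn continuous_map_mult) auto
  then have C_closed: "closedin T (C t)" if "t \<in> carrier G" for t
    unfolding C_def using that const by (intro closedin_Int closedin_eqn continuous_map_mult) auto
  \<comment> \<open>The finite intersection property of the sets \<open>C t\<close>:
    \<open>F\<close> lies in a finite subgroup \<open>H\<close> of \<open>?B\<close>, and
    acceptability applies to the finite group \<open>\<Gamma> \<times>\<times> H\<close>.\<close>
  have fip: "\<exists>g\<in>K. \<forall>t\<in>F. g \<otimes> t = t \<otimes> g" if F: "finite F" "F \<subseteq> Tor" for F
  proof -
    obtain H where H: "subgroup H (G\<lparr>carrier := ?B\<rparr>)" "finite H" "F \<subseteq> H"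
      using B.finite_torsion_subset[of F] F by (auto simp: Tor_def pow_B subset_iff)
    have HG: "subgroup H G" using incl_subgroup[OF B H(1)] .
    have HB: "H \<subseteq> ?B" using subgroup.subset[OF H(1)] by simp
    have "element_conj_imp_global (\<Gamma> \<times>\<times> G\<lparr>carrier := H\<rparr>) G"
      using \<Gamma> H(2) by (intro acceptableD[OF acc] DirProd_group subgroup_imp_group HG) auto
    from conjugator_centralizing[OF Z HG _ HB \<phi> \<Gamma>(1) this]
    obtain g where g: "g \<in> centralizer G H" "\<forall>x\<in>carrier \<Gamma>. \<phi>2 x = g \<otimes> \<phi>1 x \<otimes> inv g"
      using HB BZ by blast
    then have gG: "g \<in> carrier G" by (simp add: centralizer_def)
    have "\<phi>2 x \<otimes> g = g \<otimes> \<phi>1 x" if "x \<in> carrier \<Gamma>" for x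
      using g(2) that gG val[OF \<phi>(1) that] by (simp add: m_assoc)
    then have "g \<in> K" using gG by (simp add: K_def)
    then show ?thesis using g(1) H(3) by (auto simp: centralizer_def)
  qed
  have TorG: "Tor \<subseteq> carrier G" using B by (auto simp: Tor_def dest: subgroup.mem_carrier)
  have "\<Inter>(C ` Tor) \<noteq> {}"
  proof -
    have "\<forall>C'\<in>C ` Tor. closedin T C'" using C_closed TorG by auto
    moreover have "\<Inter>\<F> \<noteq> {}" if fin: "finite \<F>" "\<F> \<subseteq> C ` Tor" for \<F>
    proof -
      obtain F where F: "finite F" "F \<subseteq> Tor" "\<F> = C ` F" using finite_subset_image[OF fin] by blast
      obtain g where g: "g \<in> K" "\<forall>t\<in>F. g \<otimes> t = t \<otimes> g" using fip[OF F(1,2)] by blast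
      have "g \<in> carrier G" using g(1) one_\<Gamma> by (auto simp: K_def)
      then have "g \<in> \<Inter>\<F>" using g F(3) by (auto simp: C_def)
      then show ?thesis by blast
    qed
    ultimately show ?thesis using comp unfolding compact_space_fip by metis
  qed
  then obtain g where g: "g \<in> \<Inter>(C ` Tor)" by blast
  \<comment> \<open>The index set \<open>Tor\<close> is nonempty, so membership in the intersection
    does give \<open>g \<in> K\<close>.\<close>
  have "\<one> \<in> Tor" using subgroup.one_closed[OF B] by (auto simp: Tor_def intro: exI[of _ 1])
  then have gK: "g \<in> K" and gG: "g \<in> carrier G" using g unfolding C_def by blast+
  have g_Tor: "g \<otimes> t = t \<otimes> g" if "t \<in> Tor" for t using g that unfolding C_def by blast
  \<comment> \<open>The centralizer \<open>E\<close> of \<open>g\<close> is closed and contains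
    \<open>Tor\<close>. If some \<open>a\<close> of \<open>?B\<close> were outside, its open
    complement would contain a torsion element of \<open>?B\<close>.\<close>
  define E where "E = {x \<in> carrier G. g \<otimes> x = x \<otimes> g}"
  have "closedin T E" unfolding E_def using const[OF gG] by (intro closedin_eqn continuous_map_mult) auto
  have "a \<in> E" if a: "a \<in> ?B" for a
  proof (rule ccontr)
    assume "a \<notin> E"
    have "openin T (topspace T - E)" using \<open>closedin T E\<close> by (rule openin_diff[OF openin_topspace])
    moreover have "a \<in> topspace T - E" using a \<open>a \<notin> E\<close> by (simp add: topspace_eq centralizer_def)
    ultimately obtain t where "t \<in> ?B \<inter> (topspace T - E)" "\<exists>n::nat. n > 0 \<and> t [^] n = \<one>"
      using torsion_dense_centralizer[OF comp roots ZG a] by metis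
    then have "t \<in> Tor" "t \<notin> E" by (auto simp: Tor_def)
    then show False using g_Tor TorG by (auto simp: E_def)
  qed
  then have "g \<in> ?Z" using gG AB by (auto simp: E_def centralizer_def)
  moreover have "\<forall>x\<in>carrier \<Gamma>. \<phi>2 x = g \<otimes> \<phi>1 x \<otimes> inv g"
  proof
    fix x assume x: "x \<in> carrier \<Gamma>"
    have "\<phi>2 x \<otimes> g = g \<otimes> \<phi>1 x" using gK x by (simp add: K_def)
    then show "\<phi>2 x = g \<otimes> \<phi>1 x \<otimes> inv g"
      using gG val[OF \<phi>(1) x] val[OF \<phi>(2) x] by (metis inv_solve_right m_closed)
  qed
  ultimately show "globally_conjugate \<Gamma> (G\<lparr>carrier := ?Z\<rparr>) \<phi>1 \<phi>2"
    by (rule globally_conjugate_restrict[OF Z])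
qed

end

section \<open>Roots for near-additive products\<close>

text \<open>The assumption \<open>lip\<close> is what twice differentiability of a product with unit \<open>0\<close> gives: the
  deviation of \<open>m\<close> from addition is Lipschitz like a bilinear map. It keeps \<open>pw n b - n b\<close> small
  relative to \<open>n b\<close>, uniformly in \<open>n\<close>, as long as \<open>n b\<close> is small.\<close>

locale near_additive =
  fixes m :: "'e::banach \<Rightarrow> 'e \<Rightarrow> 'e" and r C :: real
  assumes r_pos: "r > 0" and C_nonneg: "C \<ge> 0" and C_r: "C * r \<le> 1 / 10"
    and m_0: "norm x \<le> r \<Longrightarrow> m 0 x = x" "norm x \<le> r \<Longrightarrow> m x 0 = x"
    and lip: "norm x \<le> r \<Longrightarrow> norm x' \<le> r \<Longrightarrow> norm y \<le> r \<Longrightarrow> norm y' \<le> r \<Longrightarrow>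
      norm ((m x y - x - y) - (m x' y' - x' - y')) \<le> C * (norm (x - x') * norm y + norm x' * norm (y - y'))"
begin

text \<open>The powers of \<open>b\<close> for the product \<open>m\<close>. The new factor stands
  on the right, as in the recursion of \<open>[^]\<close>, with which \<open>pw\<close> is later
  identified.\<close>

primrec pw :: "nat \<Rightarrow> 'e \<Rightarrow> 'e" where
  "pw 0 b = 0"
| "pw (Suc k) b = m (pw k b) b"

lemma C_r_mult: "t \<ge> 0 \<Longrightarrow> C * (r * t) \<le> t / 10"
  using mult_right_mono[OF C_r, of t] by (simp add: mult.assoc)

text \<open>Compare with \<open>x' = 0\<close> in \<open>lip\<close>: there the deviation from
  addition vanishes, and \<open>C * (norm x * norm y)\<close> is left.\<close>

lemma m_approx:
  assumes "norm x \<le> r" "norm y \<le> r"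
  shows "norm (m x y - x - y) \<le> norm y / 10"
proof -
  have "norm (m x y - x - y) \<le> C * (norm x * norm y)"
    using lip[of x 0 y y] assms m_0(1)[of y] r_pos by simp
  also have "\<dots> \<le> C * (r * norm y)"
    using assms C_nonneg by (intro mult_left_mono mult_right_mono) auto
  also have "\<dots> \<le> norm y / 10" by (rule C_r_mult) simp
  finally show ?thesis .
qed

text \<open>Each multiplication by \<open>b\<close> adds \<open>b\<close> up to an error of
  \<open>norm b / 10\<close>, and the errors add up.\<close>

lemma pw_approx:
  assumes b: "norm b \<le> r" and small: "\<And>j. j < k \<Longrightarrow> norm (pw j b) \<le> r"
  shows "norm (pw k b - real k *\<^sub>R b) \<le> real k * norm b / 10"
  using small
proof (induction k)
  case (Suc k)
  have "pw (Suc k) b - real (Suc k) *\<^sub>R b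
      = (pw k b - real k *\<^sub>R b) + (m (pw k b) b - pw k b - b)"
    by (simp add: scaleR_left_distrib)
  also have "norm \<dots> \<le> real k * norm b / 10 + norm b / 10"
    by (rule norm_triangle_mono) (use Suc m_approx[of "pw k b" b] b in auto)
  also have "\<dots> = real (Suc k) * norm b / 10" by (simp add: field_simps)
  finally show ?case .
qed simp

text \<open>By \<open>pw_approx\<close>, nine tenths of \<open>n * norm b\<close> are at most
  \<open>norm (pw n b) \<le> r\<close>; the factor 2 is generous. This bound is what makes the next
  estimate uniform in \<open>n\<close>.\<close>

lemma norm_root_le:
  assumes b: "norm b \<le> r" and small: "\<And>j. j \<le> n \<Longrightarrow> norm (pw j b) \<le> r"
  shows "real n * norm b \<le> 2 * r"
proof -
  have "norm (real n *\<^sub>R b) \<le> norm (pw n b) + norm (pw n b - real n *\<^sub>R b)"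
    using norm_triangle_ineq4[of "pw n b" "pw n b - real n *\<^sub>R b"] by simp
  then have "real n * norm b \<le> r + real n * norm b / 10"
    using pw_approx[of b n] b small[of n] small by fastforce
  then show ?thesis using r_pos by simp
qed

text \<open>Write \<open>d\<close> for \<open>norm (b - c)\<close>. By \<open>lip\<close>, step
  \<open>k\<close> adds at most
  \<open>C * (norm (pw k b - pw k c) * norm b + norm (pw k c) * d)\<close> to the error. The
  induction hypothesis and \<open>norm_root_le\<close> bound the first product by
  \<open>3 * r * d\<close>, the second is at most \<open>r * d\<close>, and
  \<open>C * r \<le> 1 / 10\<close> turns the total into
  \<open>4 * d / 10 \<le> d / 2\<close>.\<close>

lemma pw_diff_approx:
  assumes b: "norm b \<le> r" "\<And>j. j \<le> n \<Longrightarrow> norm (pw j b) \<le> r"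
    and c: "norm c \<le> r" "\<And>j. j \<le> n \<Longrightarrow> norm (pw j c) \<le> r"
    and "k \<le> n"
  shows "norm (pw k b - pw k c - real k *\<^sub>R (b - c)) \<le> real k * norm (b - c) / 2"
  using \<open>k \<le> n\<close>
proof (induction k)
  case (Suc k)
  let ?d = "norm (b - c)"
  have IH: "norm (pw k b - pw k c - real k *\<^sub>R (b - c)) \<le> real k * ?d / 2"
    using Suc by simp
  have "norm (pw k b - pw k c) \<le> real k * ?d / 2 + real k * ?d"
    using norm_triangle_mono[OF IH, of "real k *\<^sub>R (b - c)" "real k * ?d"] by simp
  also have "\<dots> \<le> real n * (3 / 2 * ?d)"
    using Suc.prems mult_right_mono[of "real k" "real n" "?d"] by simp
  finally have "norm (pw k b - pw k c) * norm b \<le> real n * (3 / 2 * ?d) * norm b"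
    by (rule mult_right_mono) simp
  also have "\<dots> = (real n * norm b) * (3 / 2 * ?d)" by simp
  also have "\<dots> \<le> 2 * r * (3 / 2 * ?d)"
    by (rule mult_right_mono[OF norm_root_le]) (use b in auto)
  finally have 1: "norm (pw k b - pw k c) * norm b \<le> r * (3 * ?d)" by simp
  have 2: "norm (pw k c) * ?d \<le> r * ?d"
    using c(2)[of k] Suc.prems by (intro mult_right_mono) auto
  have "norm ((m (pw k b) b - pw k b - b) - (m (pw k c) c - pw k c - c))
      \<le> C * (norm (pw k b - pw k c) * norm b + norm (pw k c) * ?d)"
    using b c Suc.prems by (intro lip) auto
  also have "\<dots> \<le> C * (r * (4 * ?d))"
    using 1 2 C_nonneg by (intro mult_left_mono) (auto simp: algebra_simps)
  also have "\<dots> \<le> 4 * ?d / 10" by (rule C_r_mult) simp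
  finally have step: "norm ((m (pw k b) b - pw k b - b) - (m (pw k c) c - pw k c - c)) \<le> ?d / 2"
    using norm_ge_zero[of "b - c"] by linarith
  have "pw (Suc k) b - pw (Suc k) c - real (Suc k) *\<^sub>R (b - c)
      = (pw k b - pw k c - real k *\<^sub>R (b - c))
        + ((m (pw k b) b - pw k b - b) - (m (pw k c) c - pw k c - c))"
    by (simp add: scaleR_left_distrib)
  also have "norm \<dots> \<le> real k * ?d / 2 + ?d / 2"
    by (rule norm_triangle_mono[OF IH step])
  also have "\<dots> = real (Suc k) * ?d / 2" by (simp add: field_simps)
  finally show ?case .
qed simp

section \<open>Uniqueness and existence of roots\<close>

lemma root_unique:
  assumes b: "norm b \<le> r" "\<And>j. j \<le> n \<Longrightarrow> norm (pw j b) \<le> r"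
    and c: "norm c \<le> r" "\<And>j. j \<le> n \<Longrightarrow> norm (pw j c) \<le> r"
    and "n > 0" "pw n b = pw n c"
  shows "b = c"
proof -
  have "real n * norm (b - c) \<le> real n * norm (b - c) / 2"
    using pw_diff_approx[of b n c n] assms by simp
  then show ?thesis using \<open>n > 0\<close> by simp
qed

text \<open>A bootstrap: if the bound holds for all smaller exponents, those powers have norm at
  most \<open>r\<close>, so \<open>pw_approx\<close> applies and gives the bound with factor 11/10.
  No smallness of the powers has to be assumed.\<close>

lemma pw_small:
  assumes "real n * norm b \<le> r / 2" "k \<le> n"
  shows "norm (pw k b) \<le> 2 * (real k * norm b)"
  using \<open>k \<le> n\<close>
proof (induction k rule: less_induct)
  case (less k)
  have le: "real j * norm b \<le> r / 2" if "j \<le> n" for j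
    using assms(1) mult_right_mono[of "real j" "real n" "norm b"] that by simp
  show ?case
  proof (cases "k = 0")
    case False
    have small: "norm (pw j b) \<le> r" if "j < k" for j
      using less.IH[OF that] le[of j] that less.prems by simp
    have "norm b \<le> r" using le[of 1] False less.prems r_pos by simp
    then have "norm (pw k b - real k *\<^sub>R b) \<le> real k * norm b / 10"
      using small by (rule pw_approx)
    moreover have "norm (pw k b) \<le> norm (pw k b - real k *\<^sub>R b) + norm (real k *\<^sub>R b)"
      using norm_triangle_ineq[of "pw k b - real k *\<^sub>R b" "real k *\<^sub>R b"] by simp
    moreover have "norm (real k *\<^sub>R b) = real k * norm b" by simp
    moreover have "0 \<le> real k * norm b" by simp
    ultimately show ?thesis by linarith
  qed simp
qed

text \<open>A simplified Newton iteration: \<open>pw n\<close> has derivative close to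
  \<open>n\<close> times the identity, so \<open>f\<close> contracts by 1/2 according to
  \<open>pw_diff_approx\<close>, and its fixed points solve \<open>pw n b = v\<close>. As
  \<open>norm (f 0) = norm v / n\<close>, the ball \<open>S\<close> of radius
  \<open>2 * norm v / n\<close> is mapped into itself.\<close>

lemma root_exists:
  assumes v: "4 * norm v \<le> r" and n: "n > 0"
  obtains b where "real n * norm b \<le> 2 * norm v" "pw n b = v"
proof -
  define S where "S = cball (0::'e) (2 * norm v / real n)"
  define f where "f = (\<lambda>b. b - (1 / real n) *\<^sub>R (pw n b - v))"
  have S: "real n * norm b \<le> 2 * norm v" if "b \<in> S" for b
    using that n by (simp add: S_def field_simps)
  have S_r: "real n * norm b \<le> r / 2" if "b \<in> S" for b
    using S[OF that] v by simp
  have S_small: "norm (pw j b) \<le> r" if "b \<in> S" "j \<le> n" for b j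
  proof -
    have "real j * norm b \<le> real n * norm b" using that by (intro mult_right_mono) auto
    then show ?thesis using pw_small[OF S_r that(2)] S_r that by fastforce
  qed
  have S_norm: "norm b \<le> r" if "b \<in> S" for b
  proof -
    have "1 * norm b \<le> real n * norm b" using n by (intro mult_right_mono) auto
    then show ?thesis using S_r[OF that] r_pos by simp
  qed
  have contr: "norm (f b - f c) \<le> 1 / 2 * norm (b - c)" if "b \<in> S" "c \<in> S" for b c
  proof -
    have "f b - f c = - ((1 / real n) *\<^sub>R (pw n b - pw n c - real n *\<^sub>R (b - c)))"
      using n by (simp add: f_def algebra_simps)
    also have "norm \<dots> = (1 / real n) * norm (pw n b - pw n c - real n *\<^sub>R (b - c))"
      by simp
    also have "\<dots> \<le> (1 / real n) * (real n * norm (b - c) / 2)"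
      by (rule mult_left_mono[OF pw_diff_approx[of b n c n]]) (use that S_small S_norm in auto)
    finally show ?thesis using n by simp
  qed
  have pw_0: "pw k 0 = 0" for k by (induction k) (use m_0[of 0] r_pos in auto)
  have "0 \<in> S" by (simp add: S_def)
  have f_0: "norm (f 0) = norm v / real n" by (simp add: f_def pw_0)
  have f_in: "f b \<in> S" if "b \<in> S" for b
  proof -
    have "norm (f b) \<le> norm (f b - f 0) + norm (f 0)"
      using norm_triangle_ineq[of "f b - f 0" "f 0"] by simp
    also have "\<dots> \<le> 1 / 2 * norm b + norm v / real n"
      using contr[OF that \<open>0 \<in> S\<close>] f_0 by simp
    also have "\<dots> \<le> 2 * norm v / real n" using that by (simp add: S_def)
    finally show ?thesis by (simp add: S_def)
  qed
  have "\<exists>!b\<in>S. f b = b"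
  proof (rule Banach_fix[where c = "1 / 2"])
    show "complete S" by (simp add: S_def complete_eq_closed)
    show "dist (f x) (f y) \<le> 1 / 2 * dist x y" if "x \<in> S" "y \<in> S" for x y
      using contr[OF that] by (simp add: dist_norm)
  qed (use \<open>0 \<in> S\<close> f_in in auto)
  then obtain b where b: "b \<in> S" "f b = b" by blast
  then have "pw n b = v" using n by (simp add: f_def)
  then show ?thesis using that S b by blast
qed

end

section \<open>Products of class \<open>C\<^sup>2\<close>\<close>

text \<open>\<open>Ck_on\<close> controls one pair of directions at a time: each second directional
  derivative \<open>D2 v w\<close> is continuous, hence bounded on a compact ball. The mean value
  inequality makes each \<open>D v\<close> Lipschitz, and summing over \<open>Basis\<close>, first
  in \<open>w\<close> and then in \<open>v\<close>, gives a constant uniform in the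
  directions.\<close>

lemma Ck2_Lipschitz_derivative:
  fixes f :: "'a::euclidean_space \<Rightarrow> 'b::real_normed_vector"
  assumes f: "Ck_on 2 S f" and S: "open S" "p \<in> S"
  obtains r C where "r > 0" "C \<ge> 0" "cball p r \<subseteq> S"
    "\<And>x. x \<in> cball p r \<Longrightarrow> (f has_derivative frechet_derivative f (at x)) (at x)"
    "\<And>x y v. x \<in> cball p r \<Longrightarrow> y \<in> cball p r \<Longrightarrow>
      norm (frechet_derivative f (at x) v - frechet_derivative f (at y) v) \<le> C * norm (x - y) * norm v"
proof -
  define D where "D = (\<lambda>v x. frechet_derivative f (at x) v)"
  define D2 where "D2 = (\<lambda>v w x. frechet_derivative (D v) (at x) w)"
  have f1: "f differentiable (at x)" if "x \<in> S" for x
    using f that by (simp add: numeral_2_eq_2)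
  have f2: "D v differentiable (at x)" if "x \<in> S" for v x
    using f that by (simp add: numeral_2_eq_2 D_def)
  have f3: "continuous_on S (D2 v w)" for v w
    using f by (simp add: numeral_2_eq_2 D_def D2_def)
  obtain r where r: "r > 0" "cball p r \<subseteq> S"
    using S open_contains_cball by blast
  have "\<exists>B. \<forall>x\<in>cball p r. norm (D2 v w x) \<le> B" for v w
  proof -
    have "compact (D2 v w ` cball p r)"
      using f3 r(2) by (intro compact_continuous_image) (auto intro: continuous_on_subset)
    then have "bounded (D2 v w ` cball p r)" by (rule compact_imp_bounded)
    then show ?thesis unfolding bounded_iff by simp
  qed
  then obtain B where B: "\<And>v w x. x \<in> cball p r \<Longrightarrow> norm (D2 v w x) \<le> B v w" by metis
  have dD: "(D v has_derivative (\<lambda>w. D2 v w x)) (at x)" if "x \<in> S" for v x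
    using f2[OF that, of v] by (simp add: D2_def frechet_derivative_works)
  define L where "L = (\<lambda>v. \<Sum>w\<in>Basis. B v w)"
  have on: "onorm (\<lambda>w. D2 v w x) \<le> L v" if "x \<in> cball p r" for v x
  proof -
    have bl: "bounded_linear (\<lambda>w. D2 v w x)"
      using dD that r(2) has_derivative_bounded_linear by blast
    show ?thesis
    proof (rule onorm_le)
      fix w :: 'a
      have "D2 v w x = D2 v (\<Sum>b\<in>Basis. (w \<bullet> b) *\<^sub>R b) x" by (simp add: euclidean_representation)
      also have "\<dots> = (\<Sum>b\<in>Basis. (w \<bullet> b) *\<^sub>R D2 v b x)"
        by (simp add: linear_sum[OF bounded_linear.linear[OF bl]]
            linear_scale[OF bounded_linear.linear[OF bl]])
      also have "norm \<dots> \<le> (\<Sum>b\<in>Basis. norm w * B v b)"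
      proof (rule sum_norm_le)
        fix b :: 'a assume "b \<in> Basis"
        then show "norm ((w \<bullet> b) *\<^sub>R D2 v b x) \<le> norm w * B v b"
          using B[OF that, of v b] Basis_le_norm[of b w] by (auto intro!: mult_mono)
      qed
      also have "\<dots> = L v * norm w" by (simp add: L_def sum_distrib_left mult.commute)
      finally show "norm (D2 v w x) \<le> L v * norm w" .
    qed
  qed
  have L_Lip: "norm (D v x - D v y) \<le> L v * norm (x - y)" if "x \<in> cball p r" "y \<in> cball p r" for v x y
  proof (rule differentiable_bound[of "cball p r" _ "\<lambda>x w. D2 v w x"])
    show "(D v has_derivative (\<lambda>w. D2 v w z)) (at z within cball p r)" if "z \<in> cball p r" for z
      by (rule has_derivative_at_withinI[OF dD]) (use that r(2) in auto)
  qed (use that on in auto)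
  have B0: "B v w \<ge> 0" for v w using B[of p v w] r(1) by (auto intro: order_trans[OF norm_ge_zero])
  show ?thesis
  proof
    show "r > 0" "cball p r \<subseteq> S" by fact+
    show "(\<Sum>b\<in>(Basis::'a set). L b) \<ge> 0" unfolding L_def by (intro sum_nonneg B0)
    show df: "(f has_derivative frechet_derivative f (at x)) (at x)" if "x \<in> cball p r" for x
      using f1 that r(2) by (auto simp flip: frechet_derivative_works)
    fix x y v assume xy: "x \<in> cball p r" "y \<in> cball p r"
    \<comment> \<open>\<open>L v\<close> need not be proportional to \<open>norm v\<close>;
      linearity of \<open>E\<close> reduces the claim to the finitely many basis vectors.\<close>
    define E where "E = (\<lambda>v. D v x - D v y)"
    have "bounded_linear E"
      unfolding E_def D_def using df xy by (intro bounded_linear_sub has_derivative_bounded_linear)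
    then have lin: "linear E" by (rule bounded_linear.linear)
    have "E v = E (\<Sum>b\<in>Basis. (v \<bullet> b) *\<^sub>R b)" by (simp add: euclidean_representation)
    also have "\<dots> = (\<Sum>b\<in>Basis. (v \<bullet> b) *\<^sub>R E b)"
      by (simp add: linear_sum[OF lin] linear_scale[OF lin])
    also have "norm \<dots> \<le> (\<Sum>b\<in>Basis. norm v * (L b * norm (x - y)))"
    proof (rule sum_norm_le)
      fix b :: 'a assume "b \<in> Basis"
      then show "norm ((v \<bullet> b) *\<^sub>R E b) \<le> norm v * (L b * norm (x - y))"
        using L_Lip[OF xy, of b] Basis_le_norm[of b v] by (auto intro!: mult_mono simp: E_def)
    qed
    also have "\<dots> = (\<Sum>b\<in>Basis. L b) * norm (x - y) * norm v"
      by (simp add: sum_distrib_right sum_distrib_left mult_ac)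
    finally show "norm (frechet_derivative f (at x) v - frechet_derivative f (at y) v)
        \<le> (\<Sum>b\<in>Basis. L b) * norm (x - y) * norm v" by (simp add: E_def D_def)
  qed
qed

text \<open>Since \<open>f (p, e) = p\<close>, the derivative of \<open>f (e + x, e + y) - x\<close>
  in \<open>x\<close> vanishes at \<open>y = 0\<close>, so it is at most \<open>C * norm y\<close>
  elsewhere by the Lipschitz bound, and the mean value inequality applies. The same works in
  \<open>y\<close>.\<close>

lemma product_near_additive:
  fixes f :: "'e::euclidean_space \<times> 'e \<Rightarrow> 'e"
  assumes f: "Ck_on 2 S f" and S: "open S" "(e, e) \<in> S"
    and fl: "\<And>q. (e, q) \<in> S \<Longrightarrow> f (e, q) = q" and fr: "\<And>p. (p, e) \<in> S \<Longrightarrow> f (p, e) = p"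
  obtains r C where "near_additive (\<lambda>x y. f (e + x, e + y) - e) r C"
    "\<And>x y. norm x \<le> r \<Longrightarrow> norm y \<le> r \<Longrightarrow> (e + x, e + y) \<in> S"
proof -
  obtain R C where R: "R > 0" "C \<ge> 0" "cball (e, e) R \<subseteq> S"
    and df: "\<And>z. z \<in> cball (e, e) R \<Longrightarrow> (f has_derivative frechet_derivative f (at z)) (at z)"
    and Lip: "\<And>z w v. z \<in> cball (e, e) R \<Longrightarrow> w \<in> cball (e, e) R \<Longrightarrow>
      norm (frechet_derivative f (at z) v - frechet_derivative f (at w) v) \<le> C * norm (z - w) * norm v"
    using Ck2_Lipschitz_derivative[OF f S] by metis
  define D where "D = (\<lambda>x y. frechet_derivative f (at (e + x, e + y)))"
  \<comment> \<open>The first bound keeps \<open>(e + x, e + y)\<close> in the ball of radius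
    \<open>R\<close>; the second gives \<open>C * r \<le> 1 / 10\<close>, with \<open>C + 1\<close>
    covering the case \<open>C = 0\<close>.\<close>
  define r where "r = min (R / 2) (1 / (10 * (C + 1)))"
  have r: "r > 0" "2 * r \<le> R" "C * r \<le> 1 / 10"
  proof -
    show "r > 0" using R by (simp add: r_def)
    show "2 * r \<le> R" by (simp add: r_def)
    have "C * r \<le> C * (1 / (10 * (C + 1)))" using R(2) by (intro mult_left_mono) (auto simp: r_def)
    also have "\<dots> \<le> 1 / 10" using R(2) by (simp add: field_simps)
    finally show "C * r \<le> 1 / 10" .
  qed
  have in_ball: "(e + x, e + y) \<in> cball (e, e) R" if "norm x + norm y \<le> R" for x y
    using that sqrt_sum_squares_le_sum[of "norm x" "norm y"]
    by (simp add: dist_prod_def dist_norm)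
  have in_ball': "(e + x, e + y) \<in> cball (e, e) R" if "norm x \<le> r" "norm y \<le> r" for x y
    using that r by (intro in_ball) simp
  have d1: "((\<lambda>x. f (e + x, e + y)) has_derivative (\<lambda>u. D x y (u, 0))) (at x)"
    if "norm x + norm y \<le> R" for x y
  proof -
    have "((\<lambda>x. (e + x, e + y)) has_derivative (\<lambda>u. (u, 0))) (at x)"
      by (auto intro!: derivative_eq_intros)
    then show ?thesis
      unfolding D_def
      by (rule has_derivative_compose[where f = "\<lambda>x. (e + x, e + y)" and g = f]) (rule df[OF in_ball[OF that]])
  qed
  have d2: "((\<lambda>y. f (e + x, e + y)) has_derivative (\<lambda>u. D x y (0, u))) (at y)"
    if "norm x + norm y \<le> R" for x y
  proof -
    have "((\<lambda>y. (e + x, e + y)) has_derivative (\<lambda>u. (0, u))) (at y)"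
      by (auto intro!: derivative_eq_intros)
    then show ?thesis
      unfolding D_def
      by (rule has_derivative_compose[where f = "\<lambda>y. (e + x, e + y)" and g = f]) (rule df[OF in_ball[OF that]])
  qed
  have D1: "D x 0 (u, 0) = u" if "norm x < R" for x u
  proof -
    have "((\<lambda>x. e + x) has_derivative (\<lambda>u. D x 0 (u, 0))) (at x)"
    proof (rule has_derivative_transform_within_open[where s = "ball 0 R"])
      show "((\<lambda>x. f (e + x, e + 0)) has_derivative (\<lambda>u. D x 0 (u, 0))) (at x)"
        using that by (intro d1) simp
      show "f (e + z, e + 0) = e + z" if "z \<in> ball 0 R" for z
        using in_ball[of z 0] that R(3) fr[of "e + z"] by auto
    qed (use that in auto)
    moreover have "((\<lambda>x. e + x) has_derivative (\<lambda>u. u)) (at x)" by (auto intro!: derivative_eq_intros)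
    ultimately have "(\<lambda>u. D x 0 (u, 0)) = (\<lambda>u. u)" by (rule has_derivative_unique)
    then show ?thesis by metis
  qed
  have D2: "D 0 y (0, u) = u" if "norm y < R" for y u
  proof -
    have "((\<lambda>y. e + y) has_derivative (\<lambda>u. D 0 y (0, u))) (at y)"
    proof (rule has_derivative_transform_within_open[where s = "ball 0 R"])
      show "((\<lambda>y. f (e + 0, e + y)) has_derivative (\<lambda>u. D 0 y (0, u))) (at y)"
        using that by (intro d2) simp
      show "f (e + 0, e + z) = e + z" if "z \<in> ball 0 R" for z
        using in_ball[of 0 z] that R(3) fl[of "e + z"] by auto
    qed (use that in auto)
    moreover have "((\<lambda>y. e + y) has_derivative (\<lambda>u. u)) (at y)" by (auto intro!: derivative_eq_intros)
    ultimately have "(\<lambda>u. D 0 y (0, u)) = (\<lambda>u. u)" by (rule has_derivative_unique)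
    then show ?thesis by metis
  qed
  have L1: "norm ((f (e + x, e + y) - x) - (f (e + x', e + y) - x')) \<le> C * norm y * norm (x - x')"
    if xy: "norm x \<le> r" "norm x' \<le> r" "norm y \<le> r" for x x' y
  proof (rule differentiable_bound[of "cball 0 r" "\<lambda>x. f (e + x, e + y) - x" "\<lambda>x u. D x y (u, 0) - u"])
    fix z :: 'e assume z: "z \<in> cball 0 r"
    then have "((\<lambda>x. f (e + x, e + y) - x) has_derivative (\<lambda>u. D z y (u, 0) - u)) (at z)"
      using xy r by (intro has_derivative_diff d1 has_derivative_ident) simp
    then show "((\<lambda>x. f (e + x, e + y) - x) has_derivative (\<lambda>u. D z y (u, 0) - u)) (at z within cball 0 r)"
      by (rule has_derivative_at_withinI)
    show "onorm (\<lambda>u. D z y (u, 0) - u) \<le> C * norm y"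
    proof (rule onorm_le)
      fix u :: 'e
      have "norm (D z y (u, 0) - D z 0 (u, 0)) \<le> C * norm ((e + z, e + y) - (e + z, e + 0)) * norm (u, 0::'e)"
        unfolding D_def using z xy r by (intro Lip in_ball') auto
      moreover have "D z 0 (u, 0) = u" using z r R(1) by (intro D1) simp
      ultimately show "norm (D z y (u, 0) - u) \<le> C * norm y * norm u" by (simp add: norm_prod_def)
    qed
  qed (use xy in auto)
  have L2: "norm ((f (e + x, e + y) - y) - (f (e + x, e + y') - y')) \<le> C * norm x * norm (y - y')"
    if xy: "norm x \<le> r" "norm y \<le> r" "norm y' \<le> r" for x y y'
  proof (rule differentiable_bound[of "cball 0 r" "\<lambda>y. f (e + x, e + y) - y" "\<lambda>y u. D x y (0, u) - u"])
    fix z :: 'e assume z: "z \<in> cball 0 r"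
    then have "((\<lambda>y. f (e + x, e + y) - y) has_derivative (\<lambda>u. D x z (0, u) - u)) (at z)"
      using xy r by (intro has_derivative_diff d2 has_derivative_ident) simp
    then show "((\<lambda>y. f (e + x, e + y) - y) has_derivative (\<lambda>u. D x z (0, u) - u)) (at z within cball 0 r)"
      by (rule has_derivative_at_withinI)
    show "onorm (\<lambda>u. D x z (0, u) - u) \<le> C * norm x"
    proof (rule onorm_le)
      fix u :: 'e
      have "norm (D x z (0, u) - D 0 z (0, u)) \<le> C * norm ((e + x, e + z) - (e + 0, e + z)) * norm (0::'e, u)"
        unfolding D_def using z xy r by (intro Lip in_ball') auto
      moreover have "D 0 z (0, u) = u" using z r R(1) by (intro D2) simp
      ultimately show "norm (D x z (0, u) - u) \<le> C * norm x * norm u" by (simp add: norm_prod_def)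
    qed
  qed (use xy in auto)
  have "near_additive (\<lambda>x y. f (e + x, e + y) - e) r C"
  proof
    show "r > 0" "C \<ge> 0" "C * r \<le> 1 / 10" using r R by auto
    show "f (e + 0, e + x) - e = x" "f (e + x, e + 0) - e = x" if "norm x \<le> r" for x
      using in_ball'[of 0 x] in_ball'[of x 0] fl[of "e + x"] fr[of "e + x"] that r R(3) by auto
    fix x x' y y' :: 'e
    assume *: "norm x \<le> r" "norm x' \<le> r" "norm y \<le> r" "norm y' \<le> r"
    \<comment> \<open>First \<open>x\<close> is moved to \<open>x'\<close> at fixed
      \<open>y\<close>, then \<open>y\<close> to \<open>y'\<close> at fixed \<open>x'\<close>; hence
      the factors \<open>norm y\<close> and \<open>norm x'\<close> in \<open>lip\<close>.\<close>
    have "(f (e + x, e + y) - e - x - y) - (f (e + x', e + y') - e - x' - y')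
      = ((f (e + x, e + y) - x) - (f (e + x', e + y) - x'))
        + ((f (e + x', e + y) - y) - (f (e + x', e + y') - y'))" by simp
    also have "norm \<dots> \<le> C * norm y * norm (x - x') + C * norm x' * norm (y - y')"
      by (rule norm_triangle_mono[OF L1 L2]) (use * in auto)
    also have "\<dots> = C * (norm (x - x') * norm y + norm x' * norm (y - y'))"
      by (simp add: algebra_simps)
    finally show "norm ((f (e + x, e + y) - e - x - y) - (f (e + x', e + y') - e - x' - y'))
      \<le> C * (norm (x - x') * norm y + norm x' * norm (y - y'))" .
  qed
  then show ?thesis using that in_ball' R(3) by blast
qed

section \<open>Lie groups\<close>

lemma lie_group_top_group:
  assumes "lie_group G T \<A>"
  shows "top_group G T"
proof -
  have G: "group G" "topspace T = carrier G" "Hausdorff_space T" using assms by (auto simp: lie_group_def)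
  interpret group G by (fact G(1))
  have "continuous_map (prod_topology T T) T (\<lambda>(x, y). x \<otimes>\<^bsub>G\<^esub> y) \<and> continuous_map T T (\<lambda>x. inv\<^bsub>G\<^esub> x)"
    using assms unfolding lie_group_def
  proof (elim conjE disjE)
    assume T: "T = discrete_topology (carrier G)"
    show ?thesis
      unfolding T prod_topology_discrete_topology[symmetric] by auto
  qed (auto simp: smooth_map_def)
  then show ?thesis using G by (simp add: top_group_def top_group_axioms_def)
qed

text \<open>Take \<open>{\<one>}\<close> for both neighbourhoods: a root whose first power lies in
  it is \<open>\<one>\<close>.\<close>

lemma (in top_group) small_roots_discrete:
  assumes "T = discrete_topology (carrier G)"
  shows small_roots
  unfolding small_roots_def
proof (intro conjI allI impI)
  have "b = \<one>" if "b \<in> carrier G" "n > 0" "\<forall>k\<le>n. b [^] (k::nat) \<in> {\<one>}" for b and n :: nat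
    using that(1,2) spec[OF that(3), of 1] by simp
  then have "unique_roots {\<one>}" unfolding unique_roots_def by metis
  then show "\<exists>U. openin T U \<and> \<one> \<in> U \<and> unique_roots U"
    by (intro exI[of _ "{\<one>}"]) (simp add: assms)
next
  fix W assume "\<one> \<in> W"
  then have "has_roots {\<one>} W" by (auto simp: has_roots_def intro!: bexI[of _ \<one>])
  then show "\<exists>V. openin T V \<and> \<one> \<in> V \<and> has_roots V W"
    by (intro exI[of _ "{\<one>}"]) (simp add: assms)
qed

text \<open>In coordinates centred at \<open>e = \<phi> \<one>\<close> the product is near-additive,
  so \<open>root_unique\<close> and \<open>root_exists\<close> apply. What remains is to match
  \<open>pw\<close> with powers in the group while these stay in the chart.\<close>

lemma (in top_group) small_roots_chart:
  fixes \<phi> :: "'a \<Rightarrow> 'e::euclidean_space"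
  assumes chart: "is_chart T (U, \<phi>)" and U1: "\<one> \<in> U"
    and smooth: "smooth_on (map_prod \<phi> \<phi> ` {z \<in> U \<times> U. (\<lambda>(x, y). x \<otimes> y) z \<in> U})
      (\<phi> \<circ> (\<lambda>(x, y). x \<otimes> y) \<circ> inv_into (U \<times> U) (map_prod \<phi> \<phi>))"
  shows small_roots
proof -
  have U: "openin T U" "U \<subseteq> carrier G" and P: "open (\<phi> ` U)"
    and hom: "homeomorphic_map (subtopology T U) (top_of_set (\<phi> ` U)) \<phi>"
    using chart openin_subset topspace_eq by (auto simp: is_chart_def)
  have top_U: "topspace (subtopology T U) = U" using U topspace_eq by auto
  have inj: "inj_on \<phi> U" using homeomorphic_imp_injective_map[OF hom] top_U by simp
  define \<psi> where "\<psi> = inv_into U \<phi>"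
  have \<psi>: "\<psi> p \<in> U" "\<phi> (\<psi> p) = p" if "p \<in> \<phi> ` U" for p
    using that by (auto simp: \<psi>_def inv_into_into f_inv_into_f)
  have \<psi>_\<phi>: "\<psi> (\<phi> x) = x" if "x \<in> U" for x using that inj by (simp add: \<psi>_def)
  have \<psi>_cont: "continuous_map (top_of_set (\<phi> ` U)) T \<psi>"
  proof -
    obtain g where g: "homeomorphic_maps (subtopology T U) (top_of_set (\<phi> ` U)) \<phi> g"
      using hom homeomorphic_map_maps by blast
    then have "continuous_map (top_of_set (\<phi> ` U)) T g"
      by (auto simp: homeomorphic_maps_def continuous_map_in_subtopology)
    then show ?thesis
    proof (rule continuous_map_eq)
      fix p assume "p \<in> topspace (top_of_set (\<phi> ` U))"
      then obtain x where x: "x \<in> U" "p = \<phi> x" by auto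
      then have "g p = x" using g top_U by (simp add: homeomorphic_maps_def)
      then show "g p = \<psi> p" using x \<psi>_\<phi> by simp
    qed
  qed
  have \<phi>_open: "open (\<phi> ` (W \<inter> U))" if "openin T W" for W
  proof -
    have "openin (subtopology T U) (W \<inter> U)" using that by (auto simp: openin_subtopology)
    then have "openin (top_of_set (\<phi> ` U)) (\<phi> ` (W \<inter> U))"
      using homeomorphic_imp_open_map[OF hom] by (simp add: open_map_def)
    then show ?thesis using P openin_open_trans by blast
  qed
  define e where "e = \<phi> \<one>"
  have nbhd: "openin T {x \<in> U. norm (\<phi> x - e) < s}" for s
  proof -
    have "continuous_map (subtopology T U) euclidean \<phi>"
      using homeomorphic_imp_continuous_map[OF hom] by (simp add: continuous_map_in_subtopology)
    from openin_continuous_map_preimage[OF this, of "ball e s"]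
    have "openin (subtopology T U) {x \<in> U. \<phi> x \<in> ball e s}" unfolding top_U by simp
    moreover have "{x \<in> U. \<phi> x \<in> ball e s} = {x \<in> U. norm (\<phi> x - e) < s}"
      by (auto simp: dist_norm norm_minus_commute)
    ultimately show ?thesis using openin_trans_full U(1) by metis
  qed
  \<comment> \<open>\<open>S\<close> consists of the coordinate pairs whose product stays in the
    chart, and \<open>f\<close> is the product in coordinates.\<close>
  define S where "S = map_prod \<phi> \<phi> ` {z \<in> U \<times> U. (\<lambda>(x, y). x \<otimes> y) z \<in> U}"
  define f where "f = \<phi> \<circ> (\<lambda>(x, y). x \<otimes> y) \<circ> inv_into (U \<times> U) (map_prod \<phi> \<phi>)"
  have S_iff: "z \<in> S \<longleftrightarrow> z \<in> \<phi> ` U \<times> \<phi> ` U \<and> \<psi> (fst z) \<otimes> \<psi> (snd z) \<in> U" for z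
    unfolding S_def using \<psi>_\<phi> by (cases z) (force simp: image_iff)
  have f_val: "f (p, q) = \<phi> (\<psi> p \<otimes> \<psi> q)" if "(p, q) \<in> S" for p q
  proof -
    have pq: "p \<in> \<phi> ` U" "q \<in> \<phi> ` U" using that S_iff by auto
    have "inj_on (map_prod \<phi> \<phi>) (U \<times> U)" using inj by (rule map_prod_inj_on[OF _ inj])
    moreover have "(p, q) = map_prod \<phi> \<phi> (\<psi> p, \<psi> q)" using pq \<psi> by simp
    ultimately have "inv_into (U \<times> U) (map_prod \<phi> \<phi>) (p, q) = (\<psi> p, \<psi> q)"
      using pq \<psi> by (metis SigmaI inv_into_f_f)
    then show ?thesis by (simp add: f_def)
  qed
  have open_S: "open S"
  proof -
    let ?X = "prod_topology (top_of_set (\<phi> ` U)) (top_of_set (\<phi> ` U))"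
    have "continuous_map ?X T (\<lambda>z. \<psi> (fst z) \<otimes> \<psi> (snd z))"
      by (intro continuous_map_mult continuous_map_compose[OF continuous_map_fst \<psi>_cont, unfolded comp_def]
          continuous_map_compose[OF continuous_map_snd \<psi>_cont, unfolded comp_def])
    from openin_continuous_map_preimage[OF this U(1)]
    have "openin (top_of_set (\<phi> ` U \<times> \<phi> ` U)) {z \<in> \<phi> ` U \<times> \<phi> ` U. \<psi> (fst z) \<otimes> \<psi> (snd z) \<in> U}"
      by simp
    also have "{z \<in> \<phi> ` U \<times> \<phi> ` U. \<psi> (fst z) \<otimes> \<psi> (snd z) \<in> U} = S" using S_iff by blast
    finally show ?thesis using openin_open_trans open_Times[OF P P] by blast
  qed
  have e: "e \<in> \<phi> ` U" "\<psi> e = \<one>" using U1 \<psi>_\<phi> by (auto simp: e_def)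
  have \<psi>_G: "\<psi> p \<in> carrier G" if "p \<in> \<phi> ` U" for p using \<psi>(1)[OF that] U(2) by auto
  have ee: "(e, e) \<in> S" using e U1 by (simp add: S_iff)
  have "Ck_on 2 S f" using smooth by (simp add: smooth_on_def S_def f_def)
  moreover have "f (e, q) = q" if "(e, q) \<in> S" for q
    using f_val[OF that] that e \<psi> \<psi>_G by (simp add: S_iff)
  moreover have "f (p, e) = p" if "(p, e) \<in> S" for p
    using f_val[OF that] that e \<psi> \<psi>_G by (simp add: S_iff)
  ultimately obtain r C where near: "near_additive (\<lambda>x y. f (e + x, e + y) - e) r C"
    and r_S: "\<And>x y. norm x \<le> r \<Longrightarrow> norm y \<le> r \<Longrightarrow> (e + x, e + y) \<in> S"
    using product_near_additive[OF _ open_S ee] by metis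
  interpret near_additive "\<lambda>x y. f (e + x, e + y) - e" r C by (fact near)
  have r_U: "e + x \<in> \<phi> ` U" if "norm x \<le> r" for x
    using r_S[OF that that] by (simp add: S_iff)
  show ?thesis
    unfolding small_roots_def
  proof (intro conjI allI impI)
    let ?O = "{x \<in> U. norm (\<phi> x - e) < r}"
    \<comment> \<open>From the group to coordinates: as long as the powers stay in
      \<open>?O\<close>, the pair to be multiplied lies in \<open>S\<close>. That \<open>b\<close>
      itself lies in \<open>?O\<close> is the case \<open>k = 1\<close>, available because
      \<open>n > 0\<close>.\<close>
    have pw: "pw k (\<phi> b - e) = \<phi> (b [^] k) - e"
      if "b \<in> carrier G" "n > 0" "\<forall>k\<le>n. b [^] k \<in> ?O" "k \<le> n" for b and k n :: nat
      using that(4)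
    proof (induction k)
      case 0
      show ?case by (simp flip: e_def)
    next
      case (Suc k)
      have b: "b \<in> ?O" using that(1,2) spec[OF that(3), of 1] by simp
      have bk: "b [^] k \<in> ?O" using that(3) Suc.prems by simp
      have "(e + (\<phi> (b [^] k) - e), e + (\<phi> b - e)) \<in> S" using b bk by (intro r_S) auto
      then show ?case using Suc f_val[of "\<phi> (b [^] k)" "\<phi> b"] b bk \<psi>_\<phi> by simp
    qed
    have "unique_roots ?O"
      unfolding unique_roots_def
    proof (intro ballI allI impI)
      fix b c and n :: nat
      assume *: "b \<in> carrier G" "c \<in> carrier G" "0 < n" "\<forall>k\<le>n. b [^] k \<in> ?O" "\<forall>k\<le>n. c [^] k \<in> ?O"
        "b [^] n = c [^] n"
      have bc: "b \<in> ?O" "c \<in> ?O" using *(1,2,3) spec[OF *(4), of 1] spec[OF *(5), of 1] by auto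
      have "\<phi> b - e = \<phi> c - e"
      proof (rule root_unique)
        show "norm (pw j (\<phi> b - e)) \<le> r" "norm (pw j (\<phi> c - e)) \<le> r" if "j \<le> n" for j
          using pw[OF *(1,3,4) that] pw[OF *(2,3,5) that] *(4,5) that by (auto intro: less_imp_le)
        show "pw n (\<phi> b - e) = pw n (\<phi> c - e)"
          using pw[OF *(1,3,4) order_refl] pw[OF *(2,3,5) order_refl] *(6) by simp
      qed (use bc \<open>0 < n\<close> in auto)
      then show "b = c" using bc inj by (auto dest: inj_onD)
    qed
    moreover have "\<one> \<in> ?O" using U1 r_pos by (simp add: e_def)
    ultimately show "\<exists>O'. openin T O' \<and> \<one> \<in> O' \<and> unique_roots O'" using nbhd by blast
  next
    fix W assume W: "openin T W" "\<one> \<in> W"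
    have "e \<in> \<phi> ` (W \<inter> U)" using W U1 by (simp add: e_def)
    then obtain \<epsilon> where \<epsilon>: "\<epsilon> > 0" "ball e \<epsilon> \<subseteq> \<phi> ` (W \<inter> U)"
      using \<phi>_open[OF W(1)] open_contains_ball by blast
    have \<epsilon>_W: "\<psi> (e + x) \<in> W" if "norm x < \<epsilon>" for x
    proof -
      have "e + x \<in> ball e \<epsilon>" using that by (simp add: dist_norm)
      then show ?thesis using \<epsilon>(2) \<psi>_\<phi> by fastforce
    qed
    \<comment> \<open>The root satisfies \<open>n * norm \<beta> < 2 * s\<close>, and
      \<open>pw_small\<close> doubles this. So all powers have norm below \<open>4 * s\<close>,
      hence below \<open>r\<close>, to stay in \<open>S\<close>, and below
      \<open>\<epsilon>\<close>, to stay in \<open>W\<close>.\<close>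
    define s where "s = min r \<epsilon> / 4"
    have s: "s > 0" "4 * s \<le> r" "4 * s \<le> \<epsilon>" using r_pos \<epsilon>(1) by (auto simp: s_def)
    let ?V = "{x \<in> U. norm (\<phi> x - e) < s}"
    have "has_roots ?V W"
      unfolding has_roots_def
    proof (intro ballI allI impI)
      fix v and n :: nat assume v: "v \<in> ?V" and n: "0 < n"
      have "4 * norm (\<phi> v - e) \<le> r" using v s by auto
      then obtain \<beta> where \<beta>: "real n * norm \<beta> \<le> 2 * norm (\<phi> v - e)" "pw n \<beta> = \<phi> v - e"
        using root_exists[OF _ n] by blast
      have small: "norm (pw k \<beta>) < 4 * s" if "k \<le> n" for k
      proof -
        have "norm (pw k \<beta>) \<le> 2 * (real k * norm \<beta>)"
          using \<beta>(1) v s that by (intro pw_small[of n]) auto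
        also have "\<dots> \<le> 2 * (real n * norm \<beta>)" using that by (intro mult_left_mono mult_right_mono) auto
        also have "\<dots> < 4 * s" using \<beta>(1) v by auto
        finally show ?thesis .
      qed
      have "1 * norm \<beta> \<le> real n * norm \<beta>" using n by (intro mult_right_mono) auto
      then have \<beta>_r: "norm \<beta> \<le> r" using \<beta>(1) v s by auto
      define b where "b = \<psi> (e + \<beta>)"
      have b: "b \<in> carrier G" unfolding b_def using r_U[OF \<beta>_r] by (rule \<psi>_G)
      \<comment> \<open>From coordinates back to the group: membership in \<open>S\<close> puts the
        product into \<open>U\<close>, where \<open>\<psi>\<close> inverts
        \<open>\<phi>\<close>.\<close>
      have pow: "b [^] k = \<psi> (e + pw k \<beta>)" if "k \<le> n" for k
        using that
      proof (induction k)
        case 0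
        show ?case by (simp add: e)
      next
        case (Suc k)
        have in_S: "(e + pw k \<beta>, e + \<beta>) \<in> S" using small[of k] Suc.prems s \<beta>_r by (intro r_S) auto
        then have "\<psi> (e + pw k \<beta>) \<otimes> \<psi> (e + \<beta>) \<in> U" by (simp add: S_iff)
        then show ?case using Suc f_val[OF in_S] \<psi>_\<phi> by (simp add: b_def)
      qed
      have "b [^] n = v" using pow[of n] \<beta>(2) v \<psi>_\<phi> by simp
      moreover have "\<forall>k\<le>n. b [^] k \<in> W" using pow \<epsilon>_W small s(3) by fastforce
      ultimately show "\<exists>b\<in>carrier G. b [^] n = v \<and> (\<forall>k\<le>n. b [^] k \<in> W)" using b by blast
    qed
    moreover have "\<one> \<in> ?V" using U1 s by (simp add: e_def)
    ultimately show "\<exists>V. openin T V \<and> \<one> \<in> V \<and> has_roots V W" using nbhd by blast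
  qed
qed

lemma lie_group_small_roots:
  assumes lie: "lie_group G T \<A>"
  shows "top_group.small_roots G T"
proof -
  interpret top_group G T using lie by (rule lie_group_top_group)
  consider "T = discrete_topology (carrier G)"
    | "smooth_atlas T \<A>" "smooth_map (prod_topology T T) (prod_atlas \<A> \<A>) T \<A> (\<lambda>(x, y). x \<otimes>\<^bsub>G\<^esub> y)"
    using lie unfolding lie_group_def by blast
  then show ?thesis
  proof cases
    case 1
    then show ?thesis by (rule small_roots_discrete)
  next
    case 2
    have "\<one>\<^bsub>G\<^esub> \<in> topspace T" by (simp add: topspace_eq)
    \<comment> \<open>Only multiplication near \<open>\<one>\<close> matters, so one chart around
      \<open>\<one>\<close>, paired with itself, suffices.\<close>
    then obtain U \<phi> where U: "(U, \<phi>) \<in> \<A>" "\<one>\<^bsub>G\<^esub> \<in> U"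
      using 2(1) unfolding smooth_atlas_def by blast
    show ?thesis
    proof (rule small_roots_chart)
      show "is_chart T (U, \<phi>)" using 2(1) U(1) unfolding smooth_atlas_def by blast
      have "(U \<times> U, map_prod \<phi> \<phi>) \<in> prod_atlas \<A> \<A>" using U(1) unfolding prod_atlas_def by blast
      then show "smooth_on (map_prod \<phi> \<phi> ` {z \<in> U \<times> U. (\<lambda>(x, y). x \<otimes>\<^bsub>G\<^esub> y) z \<in> U})
          (\<phi> \<circ> (\<lambda>(x, y). x \<otimes>\<^bsub>G\<^esub> y) \<circ> inv_into (U \<times> U) (map_prod \<phi> \<phi>))"
        using 2(2) U(1) unfolding smooth_map_def by fast
    qed (fact U(2))
  qed
qed

theorem lemma2p3:
  fixes G :: "('a, 'm) monoid_scheme"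
    and T :: "'a topology"
    and \<A> :: "('a, 'e::euclidean_space) chart set"
    and A :: "'a set"
  assumes "lie_group G T \<A>"
    and "compact_space T"
    and "subgroup A G"
    and "comm_group (G\<lparr>carrier := A\<rparr>)"
    and "closedin T A"
  shows "(acceptable G \<longrightarrow> acceptable (G\<lparr>carrier := centralizer G A\<rparr>)) \<and>
         (strongly_acceptable G \<longrightarrow> strongly_acceptable (G\<lparr>carrier := centralizer G A\<rparr>))"
proof -
  interpret top_group G T using assms(1) by (rule lie_group_top_group)
  show ?thesis
    using acceptable_centralizer[OF assms(2) lie_group_small_roots[OF assms(1)] _ assms(3,4)]
      strongly_acceptable_centralizer[OF _ assms(3,4)] by blast
qed

end
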